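(* Let $T>0$, $\boldsymbol{\alpha}\in\mathcal{A}$, and let $\boldsymbol{Q}_T\in\mathbb{R}^d$ be a terminal point with $\Phi_T^{-1}(\boldsymbol{Q}_T;\boldsymbol{\alpha})\in\Omega^{\circ}$. Let $\boldsymbol{q}(\cdot)=\boldsymbol{q}(\cdot;\boldsymbol{Q}_T,\boldsymbol{\alpha})$, $\log\rho$ and $G$ be as in the context. Then the Eulerian sensitivity decomposes as $$G(\boldsymbol{Q}_T,T;\boldsymbol{\alpha})=S_{\boldsymbol{\alpha}}(0)^{\top}\,\nabla\log f_0(\boldsymbol{q}(0))+r(T),$$ where $r(T)$ is the derivative of $\log\rho(0)$ with respect to $\boldsymbol{\alpha}$ at fixed $\boldsymbol{Q}_T$ and is given by $$r(T):=\bigl(\partial_{\boldsymbol{\alpha}}\log\rho(0)\bigr)_{\boldsymbol{Q}_T}=-\int_0^T\Bigl[\partial_{\boldsymbol{\alpha}}h_{\boldsymbol{\alpha}}(\boldsymbol{q}(t),t)+\bigl(\nabla_{\boldsymbol{q}}h_{\boldsymbol{\alpha}}(\boldsymbol{q}(t),t)\bigr)^{\top}S_{\boldsymbol{\alpha}}(t)\Bigr]\,dt\in\mathbb{R}^p,$$ and $S_{\boldsymbol{\alpha}}(t):=\bigl(\partial_{\boldsymbol{\alpha}}\boldsymbol{q}(t;\boldsymbol{Q}_T,\boldsymbol{\alpha})\bigr)_{\boldsymbol{Q}_T}\in\mathbb{R}^{d\times p}$ is the unique solution on $[0,T]$ of $$\dot S_{\boldsymbol{\alpha}}(t)=\nabla_{\boldsymbol{q}}\boldsymbol{R}(\boldsymbol{q}(t),t;\boldsymbol{\alpha})\,S_{\boldsymbol{\alpha}}(t)+\partial_{\boldsymbol{\alpha}}\boldsymbol{R}(\boldsymbol{q}(t),t;\boldsymbol{\alpha}),\qquad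 S_{\boldsymbol{\alpha}}(T)=\boldsymbol{0},$$ integrated from $t=T$ down to $t=0$.
   Context: Setting. $\mathcal{A}\subset\mathbb{R}^p$ is open. The vector field $\boldsymbol{R}:\mathbb{R}^d\times[0,T]\times\mathcal{A}\to\mathbb{R}^d$, written $\boldsymbol{R}(\boldsymbol{q},t;\boldsymbol{\alpha})$, is $C^1$ in $(\boldsymbol{q},t,\boldsymbol{\alpha})$ and globally Lipschitz in $\boldsymbol{q}$ uniformly in $(t,\boldsymbol{\alpha})$, with $L_R:=\sup_{(\boldsymbol{q},t,\boldsymbol{\alpha})}\|\nabla_{\boldsymbol{q}}\boldsymbol{R}(\boldsymbol{q},t;\boldsymbol{\alpha})\|<\infty$. The divergence $h_{\boldsymbol{\alpha}}(\boldsymbol{q},t):=\nabla_{\boldsymbol{q}}\cdot\boldsymbol{R}(\boldsymbol{q},t;\boldsymbol{\alpha})$ is $C^1$ in $(\boldsymbol{q},\boldsymbol{\alpha})$, and $\partial_{\boldsymbol{\alpha}}h_{\boldsymbol{\alpha}}$ and $\nabla_{\boldsymbol{q}}h_{\boldsymbol{\alpha}}$ are bounded, uniformly in $(t,\boldsymbol{\alpha})$, on every bounded set of states $\boldsymbol{q}$. The initial density $f_0$ is a probability density on $\mathbb{R}^d$ with support $\Omega\subseteq\mathbb{R}^d$; it is $C^1$ and strictly positive on the interior $\Omega^{\circ}$ of $\Omega$, $\Omega^{\circ}$ has full $f_0$-measure, and $\mathbb{E}_{\boldsymbol{q}_0\sim f_0}\|\nabla\log f_0(\boldsymbol{q}_0)\|^2<\infty$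 (gradient taken on $\Omega^{\circ}$). Flow map. For $\boldsymbol{q}_0\in\mathbb{R}^d$ and $\boldsymbol{\alpha}\in\mathcal{A}$, $t\mapsto\Phi_t(\boldsymbol{q}_0;\boldsymbol{\alpha})$ is the unique solution on $[0,T]$ of $\dot{\boldsymbol{q}}=\boldsymbol{R}(\boldsymbol{q},t;\boldsymbol{\alpha})$, $\boldsymbol{q}(0)=\boldsymbol{q}_0$; for each $(\boldsymbol{\alpha},t)$ the map $\Phi_t(\cdot;\boldsymbol{\alpha})$ is a $C^1$ diffeomorphism of $\mathbb{R}^d$. Transported density. $f(\cdot,t\mid\boldsymbol{\alpha})$ is the density of the pushforward $(\Phi_t(\cdot;\boldsymbol{\alpha}))_{\#}f_0$, i.e. the solution of the Liouville equation $\partial_t f+\nabla_{\boldsymbol{Q}}\cdot(f\boldsymbol{R})=0$, $f(\cdot,0\mid\boldsymbol{\alpha})=f_0$; on the set $\{(\Phi_t(\boldsymbol{q}_0;\boldsymbol{\alpha}),t):\boldsymbol{q}_0\in\Omega^{\circ},\,t\in[0,T]\}$ its $C^1$ version is used. Backward characteristic. For $\boldsymbol{Q}_T\in\mathbb{R}^d$, the pair $(\boldsymbol{q},\log\rho)$, with $\boldsymbol{q}(\cdot)=\boldsymbol{q}(\cdot;\boldsymbol{Q}_T,\boldsymbol{\alpha})$, is the solution on $[0,T]$ of the terminal value problem $$\frac{d\boldsymbol{q}}{dt}=\boldsymbol{R}(\boldsymbol{q},t;\boldsymbol{\alpha}),\qquad \frac{d\log\rho}{dt}=h_{\boldsymbol{\alpha}}(\boldsymbol{q},t),\qquad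 \boldsymbol{q}(T)=\boldsymbol{Q}_T,\quad \log\rho(T)=0 .$$ Notation. $(\partial_{\boldsymbol{\alpha}}\,\cdot\,)_{\boldsymbol{Q}_T}$ is the derivative with respect to $\boldsymbol{\alpha}$ with the terminal point $\boldsymbol{Q}_T$ held fixed. The Eulerian sensitivity is $$G(\boldsymbol{Q}_T,T;\boldsymbol{\alpha}):=\bigl(\partial_{\boldsymbol{\alpha}}\log f(\boldsymbol{Q}_T,T\mid\boldsymbol{\alpha})\bigr)_{\boldsymbol{Q}_T}\in\mathbb{R}^p .$$ In $\partial_{\boldsymbol{\alpha}}h_{\boldsymbol{\alpha}}(\boldsymbol{q}(t),t)$ and $\partial_{\boldsymbol{\alpha}}\boldsymbol{R}(\boldsymbol{q}(t),t;\boldsymbol{\alpha})$ the partial derivative is at fixed state argument, evaluated along the characteristic. Row and column vectors in $\mathbb{R}^p$ are identified. *)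

theory Defs
  imports "HOL-Probability.Probability"
begin

text \<open>Derivatives are taken within \<open>S\<close>, so that a closed time interval
  contributes one-sided derivatives at its end points.\<close>

definition C1_on :: "'a::real_normed_vector set \<Rightarrow> ('a \<Rightarrow> 'b::real_normed_vector) \<Rightarrow> bool" where
  "C1_on S g \<longleftrightarrow>
     (\<exists>g' :: 'a \<Rightarrow> 'a \<Rightarrow>\<^sub>L 'b.
        (\<forall>x\<in>S. (g has_derivative blinfun_apply (g' x)) (at x within S)) \<and> continuous_on S g')"

definition grad :: "(real ^ 'n \<Rightarrow> real) \<Rightarrow> real ^ 'n \<Rightarrow> real ^ 'n" where
  "grad g x = (\<chi> i. frechet_derivative g (at x) (axis i 1))"

definition divergence :: "(real ^ 'n \<Rightarrow> real ^ 'n) \<Rightarrow> real ^ 'n \<Rightarrow> real" where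
  "divergence F x = trace (jacobian F (at x))"

text \<open>\<open>div_field R a x t\<close> is the divergence $h_\alpha(q,t)$ at $\alpha = a$, $q = x$.\<close>

definition div_field :: "(real ^ 'd \<Rightarrow> real \<Rightarrow> real ^ 'p \<Rightarrow> real ^ 'd) \<Rightarrow> real ^ 'p \<Rightarrow> real ^ 'd \<Rightarrow> real \<Rightarrow> real"
  where "div_field R a x t = divergence (\<lambda>y. R y t a) x"

definition solves_ode_on :: "real set \<Rightarrow> (real \<Rightarrow> 'a \<Rightarrow> 'a::real_normed_vector) \<Rightarrow> (real \<Rightarrow> 'a) \<Rightarrow> bool" where
  "solves_ode_on I F y \<longleftrightarrow> (\<forall>t\<in>I. (y has_vector_derivative F t (y t)) (at t within I))"

text \<open>The two inclusions admit both usual readings of the support of a density,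
  the set where it is nonzero and the closure of that set.\<close>

definition is_support :: "('a::topological_space \<Rightarrow> real) \<Rightarrow> 'a set \<Rightarrow> bool" where
  "is_support g \<Omega> \<longleftrightarrow> {x. g x \<noteq> 0} \<subseteq> \<Omega> \<and> \<Omega> \<subseteq> closure {x. g x \<noteq> 0}"

definition density_measure :: "('a::euclidean_space \<Rightarrow> real) \<Rightarrow> 'a measure" where
  "density_measure g = density lborel (\<lambda>x. ennreal (g x))"

definition prob_density :: "('a::euclidean_space \<Rightarrow> real) \<Rightarrow> bool" where
  "prob_density g \<longleftrightarrow>
     g \<in> borel_measurable borel \<and> (\<forall>x. 0 \<le> g x) \<and> prob_space (density_measure g)"

text \<open>$S_\alpha(t)$, where \<open>q t Q a\<close> is the characteristic with terminal point \<open>Q\<close> and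
  parameter \<open>a\<close>; rows are indexed by the state, columns by the parameter.\<close>

definition char_sens ::
  "(real \<Rightarrow> real ^ 'd \<Rightarrow> real ^ 'p \<Rightarrow> real ^ 'd) \<Rightarrow> real ^ 'd \<Rightarrow> real ^ 'p \<Rightarrow> real \<Rightarrow> real ^ 'p ^ 'd" where
  "char_sens q Q a t = jacobian (\<lambda>b. q t Q b) (at a)"

definition eulerian_sens ::
  "(real ^ 'd \<Rightarrow> real \<Rightarrow> real ^ 'p \<Rightarrow> real) \<Rightarrow> real ^ 'd \<Rightarrow> real \<Rightarrow> real ^ 'p \<Rightarrow> real ^ 'p" where
  "eulerian_sens f Q T a = grad (\<lambda>b. ln (f Q T b)) a"

end

theory Submission
  imports Defs
begin

text \<open>The identity comes from the representation
  \<open>f Q T a = f0 (q 0 Q a) * exp (log_rho 0 Q a)\<close>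
  of the transported density in terms of the backward characteristic. It holds wherever
  \<open>q 0 Q a\<close> lies in the interior of the support, hence for \<open>Q = Q\<^sub>T\<close> and all parameters \<open>a\<close> near \<open>\<alpha>\<close>.
  Taking logarithms and differentiating in \<open>a\<close> with the chain rule gives the decomposition of
  the Eulerian sensitivity.

  To obtain the representation, the terminal point and the parameter are treated as one
  parameter \<open>z = (Q, a)\<close>. The solution of a terminal value problem is differentiable in such a parameter, with
  derivative solving the variational equation (\<open>ode_differentiable_parameter\<close>, resting on
  Gronwall's inequality and on Picard iteration). The \<open>a\<close>-part of this derivative is \<open>S\<close>; the
  \<open>Q\<close>-part is the Jacobian of the backward map \<open>Q \<mapsto> q 0 Q a\<close>, and by Liouville's formula
  (\<open>liouville_det\<close>) its determinant is \<open>exp (log_rho 0 Q a)\<close>. The backward map is the inverse of the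
  flow, so the change of variables formula (\<open>distr_density_inverse_diffeo\<close>) identifies \<open>f\<close> almost
  everywhere; as both sides are continuous on an open set, they agree at every point of it.

  The formula for \<open>r\<close> is differentiation under the integral sign
  (\<open>has_derivative_integral_dominated\<close>) in \<open>log_rho 0 Q a = - integral {0..T} (\<lambda>t. div_field R a (q t Q a) t)\<close>;
  the local bounds on the gradients of the divergence, together with a locally uniform Lipschitz bound
  for the characteristics, supply the dominating function.\<close>

section \<open>Existence and uniqueness for ordinary differential equations\<close>

text \<open>Gronwall's inequality in differential form. It is applied to differences of solutions, whose norm
  need not be differentiable; the bound on the derivative is therefore first integrated to
  \<open>norm (v t) \<le> \<phi> t\<close> with a differentiable \<open>\<phi>\<close>.\<close>

lemma gronwall_forward:
  fixes v :: "real \<Rightarrow> 'a::real_normed_vector"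
  assumes ab: "a \<le> b" and M: "0 < M" and e: "0 \<le> e"
    and der: "\<And>t. t \<in> {a..b} \<Longrightarrow> (v has_vector_derivative v' t) (at t within {a..b})"
    and bnd: "\<And>t. t \<in> {a..b} \<Longrightarrow> norm (v' t) \<le> M * norm (v t) + e"
  shows "norm (v b) \<le> (norm (v a) + e / M) * exp (M * (b - a))"
proof -
  have cont: "continuous_on {a..b} v"
    using der has_vector_derivative_continuous continuous_on_eq_continuous_within by blast
  define \<phi> where "\<phi> t = norm (v a) + integral {a..t} (\<lambda>s. M * norm (v s) + e)" for t
  have \<phi>': "(\<phi> has_vector_derivative M * norm (v t) + e) (at t within {a..b})" if "t \<in> {a..b}" for t
    unfolding \<phi>_def
    by (rule derivative_eq_intros integral_has_vector_derivative continuous_intros cont that | simp)+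
  have \<phi>a: "\<phi> a = norm (v a)" by (simp add: \<phi>_def)
  have le: "norm (v t) \<le> \<phi> t" if t: "t \<in> {a..b}" for t
  proof (cases "t = a")
    case True then show ?thesis by (simp add: \<phi>a)
  next
    case False
    then have at: "a < t" using t by auto
    have sub: "{a..t} \<subseteq> {a..b}" using t by auto
    have in': "at x within {a..b} = at x" if "a < x" "x < t" for x
      by (rule at_within_interior) (use that t in auto)
    have "norm (v t - v a) \<le> \<phi> t - \<phi> a"
    proof (rule differentiable_bound_general[OF at])
      show "continuous_on {a..t} v" using cont sub continuous_on_subset by blast
      show "continuous_on {a..t} \<phi>"
        using \<phi>' sub by (meson continuous_on_eq_continuous_within continuous_on_subset has_vector_derivative_continuous)
      show "(v has_vector_derivative v' x) (at x)" if "a < x" "x < t" for x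
        using der[of x] in'[OF that] that t by auto
      show "(\<phi> has_vector_derivative M * norm (v x) + e) (at x)" if "a < x" "x < t" for x
        using \<phi>'[of x] in'[OF that] that t by auto
      show "norm (v' x) \<le> M * norm (v x) + e" if "a < x" "x < t" for x
        using bnd[of x] that t by auto
    qed
    moreover have "norm (v t) \<le> norm (v t - v a) + norm (v a)"
      by (metis diff_add_cancel norm_triangle_ineq)
    ultimately show ?thesis by (simp add: \<phi>a)
  qed
  define \<psi> where "\<psi> t = (\<phi> t + e / M) * exp (- M * (t - a))" for t
  \<comment> \<open>\<open>\<phi>' \<le> M * \<phi> + e\<close>, so multiplying by the integrating factor gives a nonincreasing function\<close>
  have "\<psi> b \<le> \<psi> a"
  proof (rule DERIV_nonpos_imp_decreasing_open[OF ab])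
    fix x assume x: "a < x" "x < b"
    have "at x within {a..b} = at x"
      by (rule at_within_interior) (use x in auto)
    then have d: "(\<phi> has_real_derivative M * norm (v x) + e) (at x)"
      using \<phi>'[of x] x by (auto simp: has_real_derivative_iff_has_vector_derivative)
    have "(\<psi> has_real_derivative (M * norm (v x) - M * \<phi> x) * exp (- M * (x - a))) (at x)"
      unfolding \<psi>_def using M
      by (auto intro!: derivative_eq_intros d simp: field_simps)
    moreover have "(M * norm (v x) - M * \<phi> x) * exp (- M * (x - a)) \<le> 0"
      using le[of x] x M by (simp add: mult_nonpos_nonneg)
    ultimately show "\<exists>y. (\<psi> has_real_derivative y) (at x) \<and> y \<le> 0" by blast
  next
    have "continuous_on {a..b} \<phi>"
      using \<phi>' has_vector_derivative_continuous continuous_on_eq_continuous_within by blast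
    then show "continuous_on {a..b} \<psi>" unfolding \<psi>_def by (intro continuous_intros)
  qed
  then have "(\<phi> b + e / M) * exp (- (M * (b - a))) \<le> norm (v a) + e / M"
    by (simp add: \<psi>_def \<phi>a)
  then have "\<phi> b + e / M \<le> (norm (v a) + e / M) * exp (M * (b - a))"
    unfolding exp_minus by (simp only: divide_inverse[symmetric] pos_divide_le_eq[OF exp_gt_zero])
  moreover have "norm (v b) \<le> \<phi> b" using le ab by auto
  moreover have "0 \<le> e / M" using M e by simp
  ultimately show ?thesis by linarith
qed

text \<open>Two-sided form: \<open>s\<close> and \<open>t\<close> may come in either order, because terminal value problems
  are integrated backwards. The backward case is the forward one for \<open>\<lambda>x. v (- x)\<close>.\<close>

lemma gronwall:
  fixes v :: "real \<Rightarrow> 'a::real_normed_vector"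
  assumes st: "s \<in> {a..b}" "t \<in> {a..b}" and M: "0 < M" and e: "0 \<le> e"
    and der: "\<And>t. t \<in> {a..b} \<Longrightarrow> (v has_vector_derivative v' t) (at t within {a..b})"
    and bnd: "\<And>t. t \<in> {a..b} \<Longrightarrow> norm (v' t) \<le> M * norm (v t) + e"
  shows "norm (v t) \<le> (norm (v s) + e / M) * exp (M * \<bar>t - s\<bar>)"
proof (cases "s \<le> t")
  case True
  have "norm (v t) \<le> (norm (v s) + e / M) * exp (M * (t - s))"
  proof (rule gronwall_forward[OF True M e])
    fix x assume x: "x \<in> {s..t}"
    then show "(v has_vector_derivative v' x) (at x within {s..t})"
      using der[of x] st by (auto intro: has_vector_derivative_within_subset)
    show "norm (v' x) \<le> M * norm (v x) + e" using bnd x st by auto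
  qed
  then show ?thesis using True by simp
next
  case False
  define w where "w x = v (- x)" for x
  have "norm (w (- t)) \<le> (norm (w (- s)) + e / M) * exp (M * (- t - - s))"
  proof (rule gronwall_forward[where v' = "\<lambda>x. - v' (- x)", OF _ M e])
    show "- s \<le> - t" using False by simp
    fix x assume x: "x \<in> {- s..- t}"
    have "(v has_vector_derivative v' (- x)) (at (- x) within uminus ` {- s..- t})"
      by (rule has_vector_derivative_within_subset[OF der]) (use x st in auto)
    moreover have "(uminus has_vector_derivative - 1) (at x within {- s..- t})"
      by (rule has_vector_derivative_minus[OF has_vector_derivative_id])
    ultimately show "(w has_vector_derivative - v' (- x)) (at x within {- s..- t})"
      using vector_diff_chain_within[of uminus "- 1" x "{- s..- t}" v "v' (- x)"]
      by (simp add: w_def[abs_def] o_def)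
    show "norm (- v' (- x)) \<le> M * norm (w x) + e" using bnd[of "- x"] x st by (auto simp: w_def)
  qed
  then show ?thesis using False by (simp add: w_def)
qed

lemma ode_solution_unique:
  fixes x y :: "real \<Rightarrow> 'a::real_normed_vector"
  assumes sol: "solves_ode_on {a..b} F x" "solves_ode_on {a..b} F y"
    and lip: "\<And>t u v. t \<in> {a..b} \<Longrightarrow> norm (F t u - F t v) \<le> L * norm (u - v)"
    and st: "s \<in> {a..b}" "t \<in> {a..b}" and eq: "x s = y s"
  shows "x t = y t"
proof -
  have "norm (x t - y t) \<le> (norm (x s - y s) + 0 / max 1 L) * exp (max 1 L * \<bar>t - s\<bar>)"
  proof (rule gronwall[OF st])
    fix r assume r: "r \<in> {a..b}"
    show "((\<lambda>t. x t - y t) has_vector_derivative F r (x r) - F r (y r)) (at r within {a..b})"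
      using sol r by (auto simp: solves_ode_on_def intro!: derivative_intros)
    have "L * norm (x r - y r) \<le> max 1 L * norm (x r - y r)"
      by (intro mult_right_mono) auto
    then show "norm (F r (x r) - F r (y r)) \<le> max 1 L * norm (x r - y r) + 0"
      using lip[OF r, of "x r" "y r"] by linarith
  qed auto
  then show ?thesis using eq by simp
qed

text \<open>The Picard iterates converge on the whole interval, since consecutive ones differ by at most
  \<open>C * L ^ n * (t - a) ^ Suc n / fact (Suc n)\<close>; no smallness of \<open>b - a\<close> is needed for a globally
  Lipschitz field.\<close>

lemma picard_lindelof_global:
  fixes F :: "real \<Rightarrow> 'a::banach \<Rightarrow> 'a"
  assumes ab: "a \<le> b" and L: "0 \<le> L"
    and cont: "continuous_on ({a..b} \<times> UNIV) (\<lambda>(t, x). F t x)"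
    and lip: "\<And>t u v. t \<in> {a..b} \<Longrightarrow> norm (F t u - F t v) \<le> L * norm (u - v)"
  obtains y where "y a = y0" "solves_ode_on {a..b} F y"
proof -
  define w where "w = rec_nat (\<lambda>t. y0) (\<lambda>n wn t. y0 + integral {a..t} (\<lambda>s. F s (wn s)))"
  have w0: "w 0 = (\<lambda>t. y0)" and wSuc: "w (Suc n) = (\<lambda>t. y0 + integral {a..t} (\<lambda>s. F s (w n s)))" for n
    by (simp_all add: w_def)
  have wa: "w n a = y0" for n by (cases n) (simp_all add: w0 wSuc)
  have contF: "continuous_on {a..b} (\<lambda>s. F s (u s))" if "continuous_on {a..b} u" for u
    using continuous_on_compose2[OF cont continuous_on_Pair[OF continuous_on_id that]] by auto
  have cd: "continuous_on {a..b} f" if "\<And>t. t \<in> {a..b} \<Longrightarrow> (f has_vector_derivative f' t) (at t within {a..b})"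
    for f :: "real \<Rightarrow> 'a" and f'
    using that has_vector_derivative_continuous continuous_on_eq_continuous_within by blast
  have contw: "continuous_on {a..b} (w n)" for n
  proof (induction n)
    case 0 then show ?case by (simp add: w0)
  next
    case (Suc n)
    show ?case unfolding wSuc
      by (rule cd) (rule derivative_eq_intros integral_has_vector_derivative contF Suc refl | assumption)+
  qed
  have der: "(w (Suc n) has_vector_derivative F t (w n t)) (at t within {a..b})" if "t \<in> {a..b}" for n t
    unfolding wSuc
    by (rule derivative_eq_intros integral_has_vector_derivative contF contw refl that | simp)+
  obtain C where C: "\<And>t. t \<in> {a..b} \<Longrightarrow> norm (F t y0) \<le> C" and C0: "0 \<le> C"
  proof -
    have "compact ((\<lambda>s. F s y0) ` {a..b})"
      by (intro compact_continuous_image contF continuous_on_const compact_Icc)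
    then have "bounded ((\<lambda>s. F s y0) ` {a..b})" by (rule compact_imp_bounded)
    then obtain C where "0 < C" "\<forall>x\<in>(\<lambda>s. F s y0) ` {a..b}. norm x \<le> C" by (auto simp: bounded_pos)
    then show ?thesis by (intro that[of C]) auto
  qed
  define \<phi> where "\<phi> n t = C * L ^ n * (t - a) ^ Suc n / fact (Suc n)" for n t
  have d\<phi>: "(\<phi> (Suc n) has_vector_derivative L * \<phi> n t) (at t)" for n t
  proof -
    have f: "(fact (Suc (Suc n)) :: real) = real (Suc (Suc n)) * fact (Suc n)" by simp
    show ?thesis unfolding \<phi>_def has_real_derivative_iff_has_vector_derivative[symmetric] f
      by (rule derivative_eq_intros refl | simp del: fact_Suc)+
  qed
  have d\<phi>0: "(\<phi> 0 has_vector_derivative C) (at t)" for t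
    unfolding \<phi>_def has_real_derivative_iff_has_vector_derivative[symmetric]
    by (auto intro!: derivative_eq_intros)
  have \<phi>cont: "continuous_on S (\<phi> n)" for S n unfolding \<phi>_def by (intro continuous_intros) auto
  have \<phi>a: "\<phi> n a = 0" for n by (simp add: \<phi>_def)
  have step: "norm (w (Suc n) t - w n t) \<le> \<phi> n t" if t: "t \<in> {a..b}" for n t
    using t
  proof (induction n arbitrary: t)
    case 0
    show ?case
    proof (cases "t = a")
      case True then show ?thesis by (simp add: wa \<phi>a)
    next
      case False
      with 0 have "a < t" by auto
      have "norm (w 1 t - w 1 a) \<le> \<phi> 0 t - \<phi> 0 a"
      proof (rule differentiable_bound_general[OF \<open>a < t\<close> _ \<phi>cont _ d\<phi>0])
        show "continuous_on {a..t} (w 1)" by (rule continuous_on_subset[OF contw]) (use 0 in auto)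
        fix x assume x: "a < x" "x < t"
        have "at x within {a..b} = at x" by (rule at_within_interior) (use x 0 in auto)
        then show "(w 1 has_vector_derivative F x (w 0 x)) (at x)" using der[of x 0] x 0 by auto
        show "norm (F x (w 0 x)) \<le> C" using C x 0 by (auto simp: w0)
      qed
      then show ?thesis by (simp add: wa \<phi>a w0)
    qed
  next
    case (Suc n)
    show ?case
    proof (cases "t = a")
      case True then show ?thesis by (simp add: wa \<phi>a)
    next
      case False
      with Suc.prems have "a < t" by auto
      have "norm ((w (Suc (Suc n)) t - w (Suc n) t) - (w (Suc (Suc n)) a - w (Suc n) a)) \<le> \<phi> (Suc n) t - \<phi> (Suc n) a"
      proof (rule differentiable_bound_general[OF \<open>a < t\<close> _ \<phi>cont _ d\<phi>])
        show "continuous_on {a..t} (\<lambda>t. w (Suc (Suc n)) t - w (Suc n) t)"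
          using contw Suc.prems by (auto intro!: continuous_on_subset[OF contw] continuous_intros)
        fix x assume x: "a < x" "x < t"
        have "at x within {a..b} = at x" by (rule at_within_interior) (use x Suc.prems in auto)
        then show "((\<lambda>t. w (Suc (Suc n)) t - w (Suc n) t) has_vector_derivative
            F x (w (Suc n) x) - F x (w n x)) (at x)"
          using der[of x "Suc n"] der[of x n] x Suc.prems by (auto intro!: derivative_intros)
        have "norm (F x (w (Suc n) x) - F x (w n x)) \<le> L * norm (w (Suc n) x - w n x)"
          using lip x Suc.prems by auto
        also have "\<dots> \<le> L * \<phi> n x" using Suc.IH[of x] x Suc.prems L by (auto intro: mult_left_mono)
        finally show "norm (F x (w (Suc n) x) - F x (w n x)) \<le> L * \<phi> n x" .
      qed
      then show ?thesis by (simp add: wa \<phi>a)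
    qed
  qed
  define D where "D = b - a"
  have D: "0 \<le> D" using ab by (simp add: D_def)
  define m where "m n = C * D * (L * D) ^ n / fact n" for n
  have bd: "norm (w (Suc n) t - w n t) \<le> m n" if t: "t \<in> {a..b}" for n t
  proof -
    have "\<phi> n t \<le> C * L ^ n * D ^ Suc n / fact n"
      unfolding \<phi>_def D_def using t C0 L
      by (intro frac_le mult_left_mono power_mono mult_nonneg_nonneg fact_mono) auto
    also have "\<dots> = m n" by (simp add: m_def power_mult_distrib)
    finally show ?thesis using step[OF t, of n] by linarith
  qed
  have "summable (\<lambda>n. C * D * (inverse (fact n) * (L * D) ^ n))"
    by (intro summable_mult summable_exp)
  then have "summable m" by (simp add: m_def[abs_def] field_simps)
  have telescope: "w n t = y0 + (\<Sum>i<n. w (Suc i) t - w i t)" for n t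
    by (induction n) (simp_all add: w0 algebra_simps)
  define y where "y t = y0 + (\<Sum>i. w (Suc i) t - w i t)" for t
  have ul0: "uniform_limit {a..b} (\<lambda>n t. \<Sum>i<n. w (Suc i) t - w i t) (\<lambda>t. \<Sum>i. w (Suc i) t - w i t) sequentially"
    by (rule Weierstrass_m_test[OF bd \<open>summable m\<close>])
  have wdist: "dist (w n t) (y t) = dist (\<Sum>i<n. w (Suc i) t - w i t) (\<Sum>i. w (Suc i) t - w i t)" for n t
    by (subst telescope) (simp add: y_def dist_norm)
  have ul: "uniform_limit {a..b} w y sequentially"
    using ul0 unfolding uniform_limit_iff wdist .
  have wy: "(\<lambda>n. w n t) \<longlonglongrightarrow> y t" if "t \<in> {a..b}" for t
    by (rule tendsto_uniform_limitI[OF ul that])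
  have ev: "\<forall>\<^sub>F n in sequentially. \<forall>x\<in>{a..b}. \<forall>h. norm (h *\<^sub>R F x (w n x) - h *\<^sub>R F x (y x)) \<le> e * norm h"
    if e: "0 < e" for e
  proof -
    have "0 < e / (L + 1)" using e L by simp
    from uniform_limitD[OF ul this] show ?thesis
    proof eventually_elim
      case (elim n)
      show ?case
      proof (intro ballI allI)
        fix x h assume x: "x \<in> {a..b}"
        have "norm (F x (w n x) - F x (y x)) \<le> L * norm (w n x - y x)" using lip x by auto
        also have "\<dots> \<le> (L + 1) * (e / (L + 1))"
          using elim x L by (intro mult_mono) (auto simp: dist_norm less_imp_le)
        also have "\<dots> = e" using L by simp
        finally show "norm (h *\<^sub>R F x (w n x) - h *\<^sub>R F x (y x)) \<le> e * norm h"
          unfolding scaleR_diff_right[symmetric] norm_scaleR real_norm_def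
          by (metis abs_ge_zero mult.commute mult_left_mono)
      qed
    qed
  qed
  \<comment> \<open>the derivatives \<open>F x (w n x)\<close> of the iterates converge uniformly, so the limit may be differentiated termwise\<close>
  have "\<exists>g. \<forall>x\<in>{a..b}. (\<lambda>n. w (Suc n) x) \<longlonglongrightarrow> g x \<and> (g has_derivative (\<lambda>h. h *\<^sub>R F x (y x))) (at x within {a..b})"
  proof (rule has_derivative_sequence[where f' = "\<lambda>n x h. h *\<^sub>R F x (w n x)"])
    show "convex {a..b}" by simp
    show "(w (Suc n) has_derivative (\<lambda>h. h *\<^sub>R F x (w n x))) (at x within {a..b})" if "x \<in> {a..b}" for n x
      using der[OF that] by (simp add: has_vector_derivative_def)
    show "\<forall>\<^sub>F n in sequentially. \<forall>x\<in>{a..b}. \<forall>h. norm (h *\<^sub>R F x (w n x) - h *\<^sub>R F x (y x)) \<le> e * norm h"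
      if "0 < e" for e by (rule ev[OF that])
    show "a \<in> {a..b}" using ab by simp
    then show "(\<lambda>n. w (Suc n) a) \<longlonglongrightarrow> y a" by (intro LIMSEQ_Suc wy)
  qed
  then obtain g where g: "\<And>x. x \<in> {a..b} \<Longrightarrow> (\<lambda>n. w (Suc n) x) \<longlonglongrightarrow> g x"
    "\<And>x. x \<in> {a..b} \<Longrightarrow> (g has_vector_derivative F x (y x)) (at x within {a..b})"
    unfolding has_vector_derivative_def by blast
  have gy: "g x = y x" if "x \<in> {a..b}" for x
    using LIMSEQ_unique[OF g(1)[OF that] LIMSEQ_Suc[OF wy[OF that]]] .
  show thesis
  proof
    show "y a = y0" by (simp add: y_def wa)
    show "solves_ode_on {a..b} F y" unfolding solves_ode_on_def
    proof
      fix t assume t: "t \<in> {a..b}"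
      show "(y has_vector_derivative F t (y t)) (at t within {a..b})"
        by (rule has_vector_derivative_transform[OF t _ g(2)[OF t]]) (simp add: gy)
    qed
  qed
qed

section \<open>Differentiable dependence on parameters\<close>

text \<open>Along the curve of the points \<open>(y t, t, z0)\<close> the linearization of \<open>F\<close> in \<open>(x, z)\<close>
  approximates \<open>F\<close> uniformly in \<open>t\<close>. Compactness is needed of the set \<open>I\<close> of times only, so the
  state and parameter spaces may be of infinite dimension.\<close>

lemma uniform_linearization:
  fixes F :: "'e::real_normed_vector \<Rightarrow> real \<Rightarrow> 'z::real_normed_vector \<Rightarrow> 'f::real_normed_vector"
    and DF :: "'e \<times> real \<times> 'z \<Rightarrow> ('e \<times> 'z) \<Rightarrow>\<^sub>L 'f"
  assumes U: "open U" "z0 \<in> U" and I: "compact I" and y: "continuous_on I y"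
    and der: "\<And>t x z. t \<in> I \<Longrightarrow> z \<in> U \<Longrightarrow> ((\<lambda>(x, z). F x t z) has_derivative blinfun_apply (DF (x, t, z))) (at (x, z))"
    and cont: "continuous_on (UNIV \<times> I \<times> U) DF"
    and e: "0 < e"
  obtains d where "0 < d" "ball z0 d \<subseteq> U"
    "\<And>t u v. t \<in> I \<Longrightarrow> norm (u, v) < d \<Longrightarrow>
       norm (F (y t + u) t (z0 + v) - F (y t) t z0 - DF (y t, t, z0) (u, v)) \<le> e * norm (u, v)"
proof -
  obtain r where r: "0 < r" "ball z0 r \<subseteq> U" using U open_contains_ball by blast
  have inU: "z0 + snd w \<in> U" if "norm w < r" for w :: "'e \<times> 'z"
  proof -
    have "norm (snd w) < r" using that norm_snd_le[of "snd w" "fst w"] by simp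
    then show ?thesis using r(2) by (auto simp: dist_norm subset_iff)
  qed
  define G where "G = (\<lambda>(w, t). DF (y t + fst w, t, z0 + snd w))"
  have "continuous_on (ball 0 r \<times> I) G"
    unfolding G_def split_beta'
    by (rule continuous_on_compose2[OF cont])
       (auto intro!: continuous_intros continuous_on_compose2[OF y] inU)
  from continuous_on_prod_compactE[OF this I, of 0 e] obtain X0 where X0: "0 \<in> X0" "open X0"
    "\<forall>w\<in>X0 \<inter> ball 0 r. \<forall>t\<in>I. dist (G (w, t)) (G (0, t)) \<le> e"
    using r e by auto
  obtain d0 where d0: "0 < d0" "ball 0 d0 \<subseteq> X0" using X0 open_contains_ball by blast
  define d where "d = min d0 r"
  show thesis
  proof
    show "0 < d" using d0 r by (simp add: d_def)
    show "ball z0 d \<subseteq> U" using r by (auto simp: d_def)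
    fix t u v assume t: "t \<in> I" and w: "norm (u :: 'e, v :: 'z) < d"
    define H where "H w = F (y t + fst w) t (z0 + snd w) - DF (y t, t, z0) w" for w
    have "norm (H (u, v) - H 0) \<le> e * norm ((u, v) - 0)"
    proof (rule differentiable_bound[where S = "ball 0 d" and f' = "\<lambda>w. blinfun_apply (G (w, t) - G (0, t))"])
      fix w :: "'e \<times> 'z" assume wd: "w \<in> ball 0 d"
      have "((\<lambda>w. (y t + fst w, z0 + snd w)) has_derivative (\<lambda>w. w)) (at w)"
        by (auto intro!: derivative_eq_intros)
      from has_derivative_compose[OF this, of "\<lambda>(x, z). F x t z"] der[OF t inU[of w], of "y t + fst w"] wd
      have "((\<lambda>w. F (y t + fst w) t (z0 + snd w)) has_derivative
          blinfun_apply (DF (y t + fst w, t, z0 + snd w))) (at w)"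
        by (auto simp: d_def)
      then have "(H has_derivative blinfun_apply (G (w, t) - G (0, t))) (at w)"
        unfolding H_def G_def
        by (auto intro!: derivative_eq_intros simp: blinfun.diff_left)
      then show "(H has_derivative blinfun_apply (G (w, t) - G (0, t))) (at w within ball 0 d)"
        by (rule has_derivative_at_withinI)
      show "onorm (blinfun_apply (G (w, t) - G (0, t))) \<le> e"
        using X0(3) d0(2) wd t unfolding norm_blinfun.rep_eq[symmetric] dist_norm d_def by auto
    qed (use w \<open>0 < d\<close> in auto)
    then show "norm (F (y t + u) t (z0 + v) - F (y t) t z0 - DF (y t, t, z0) (u, v)) \<le> e * norm (u, v)"
      by (simp add: H_def algebra_simps blinfun.zero_right)
  qed
qed

lemma has_derivative_iff_eventually:
  fixes f :: "'a::real_normed_vector \<Rightarrow> 'b::real_normed_vector"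
  shows "(f has_derivative f') (at x) \<longleftrightarrow>
     bounded_linear f' \<and> (\<forall>e>0. \<forall>\<^sub>F z in nhds x. norm (f z - f x - f' (z - x)) \<le> e * norm (z - x))"
  unfolding has_derivative_at_alt eventually_nhds_metric dist_norm by auto

lemma continuous_on_solution:
  fixes y :: "real \<Rightarrow> 'a::real_normed_vector"
  assumes "solves_ode_on I F y"
  shows "continuous_on I y"
  using assms has_vector_derivative_continuous
  unfolding solves_ode_on_def continuous_on_eq_continuous_within by blast

text \<open>Time reversal of \<open>picard_lindelof_global\<close>.\<close>

lemma picard_lindelof_terminal:
  fixes F :: "real \<Rightarrow> 'a::banach \<Rightarrow> 'a"
  assumes ab: "a \<le> b" and L: "0 \<le> L"
    and cont: "continuous_on ({a..b} \<times> UNIV) (\<lambda>(t, x). F t x)"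
    and lip: "\<And>t u v. t \<in> {a..b} \<Longrightarrow> norm (F t u - F t v) \<le> L * norm (u - v)"
  obtains y where "y b = y0" "solves_ode_on {a..b} F y"
proof -
  have "- b \<le> - a" using ab by simp
  moreover have "continuous_on ({- b..- a} \<times> UNIV) (\<lambda>(t, x). - F (- t) x)"
  proof -
    have "continuous_on ({- b..- a} \<times> UNIV) (\<lambda>p. (\<lambda>(t, x). F t x) (- fst p, snd p))"
      by (rule continuous_on_compose2[OF cont]) (auto intro!: continuous_intros)
    then show ?thesis by (simp add: split_beta' continuous_on_minus)
  qed
  moreover have "norm (- F (- t) u - - F (- t) v) \<le> L * norm (u - v)" if "t \<in> {- b..- a}" for t u v
    using lip[of "- t" u v] that by (simp add: norm_minus_commute)
  ultimately obtain w where w: "w (- b) = y0" "solves_ode_on {- b..- a} (\<lambda>t x. - F (- t) x) w"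
    using picard_lindelof_global[of "- b" "- a" L "\<lambda>t x. - F (- t) x" y0] L by blast
  show thesis
  proof
    show "w (- b) = y0" by (rule w)
    show "solves_ode_on {a..b} F (\<lambda>t. w (- t))"
      unfolding solves_ode_on_def
    proof
      fix t assume t: "t \<in> {a..b}"
      have "(uminus has_vector_derivative - 1) (at t within {a..b})"
        by (rule has_vector_derivative_minus[OF has_vector_derivative_id])
      moreover have "(w has_vector_derivative - F t (w (- t))) (at (- t) within uminus ` {a..b})"
        using w(2)[unfolded solves_ode_on_def, rule_format, of "- t"] t by simp
      ultimately show "((\<lambda>t. w (- t)) has_vector_derivative F t (w (- t))) (at t within {a..b})"
        using vector_diff_chain_within[of uminus "- 1" t "{a..b}" w "- F t (w (- t))"]
        by (simp add: o_def)
    qed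
  qed
qed

text \<open>The solutions of a terminal value problem depend differentiably on a parameter that enters both
  the field and the terminal value. The derivative \<open>W t\<close> solves the variational equation, which is
  stated for each direction \<open>h\<close>. The locally uniform Lipschitz bound in the last conclusion
  provides the dominating function when an integral along the solution is differentiated.\<close>

theorem ode_differentiable_parameter:
  fixes F :: "'e::banach \<Rightarrow> real \<Rightarrow> 'z::real_normed_vector \<Rightarrow> 'e"
    and DF :: "'e \<times> real \<times> 'z \<Rightarrow> ('e \<times> 'z) \<Rightarrow>\<^sub>L 'e"
    and y :: "real \<Rightarrow> 'z \<Rightarrow> 'e"
  assumes ab: "a \<le> b" and U: "open U" "z0 \<in> U"
    and der: "\<And>x t z. t \<in> {a..b} \<Longrightarrow> z \<in> U \<Longrightarrow> ((\<lambda>(x, z). F x t z) has_derivative blinfun_apply (DF (x, t, z))) (at (x, z))"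
    and cont: "continuous_on (UNIV \<times> {a..b} \<times> U) DF"
    and lip: "\<And>x x' t z. t \<in> {a..b} \<Longrightarrow> z \<in> U \<Longrightarrow> norm (F x t z - F x' t z) \<le> L * norm (x - x')"
    and sol: "\<And>z. z \<in> U \<Longrightarrow> solves_ode_on {a..b} (\<lambda>t x. F x t z) (\<lambda>t. y t z)"
    and terminal: "(y b has_derivative blinfun_apply c) (at z0)"
  obtains W K where "W b = c" "\<And>t. t \<in> {a..b} \<Longrightarrow> (y t has_derivative blinfun_apply (W t)) (at z0)"
    "\<And>t h. t \<in> {a..b} \<Longrightarrow>
        ((\<lambda>t. W t h) has_vector_derivative DF (y t z0, t, z0) (W t h, h)) (at t within {a..b})"
    "\<forall>\<^sub>F z in nhds z0. z \<in> U \<and> (\<forall>t\<in>{a..b}. norm (y t z - y t z0) \<le> K * norm (z - z0))"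
proof -
  define y0 where "y0 t = y t z0" for t
  have cy: "continuous_on {a..b} y0"
    using continuous_on_solution[OF sol[OF U(2)]] by (simp add: y0_def[abs_def])
  define D where "D t = DF (y0 t, t, z0)" for t
  have cD: "continuous_on {a..b} D" unfolding D_def
    by (rule continuous_on_compose2[OF cont]) (auto intro!: continuous_intros cy U)
  define inl :: "'e \<Rightarrow>\<^sub>L ('e \<times> 'z)" where "inl = Blinfun (\<lambda>x. (x, 0))"
  define inr :: "'z \<Rightarrow>\<^sub>L ('e \<times> 'z)" where "inr = Blinfun (\<lambda>z. (0, z))"
  have inl: "inl x = (x, 0)" for x
    unfolding inl_def
    by (simp add: bounded_linear_Blinfun_apply[OF bounded_linear_Pair[OF bounded_linear_ident bounded_linear_zero]])
  have inr: "inr z = (0, z)" for z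
    unfolding inr_def
    by (simp add: bounded_linear_Blinfun_apply[OF bounded_linear_Pair[OF bounded_linear_zero bounded_linear_ident]])
  have split: "D t (x, z) = D t (x, 0) + D t (0, z)" for t x z
    by (simp add: blinfun.add_right[symmetric])
  obtain B where B: "0 < B" "\<And>t. t \<in> {a..b} \<Longrightarrow> norm (D t) \<le> B"
  proof -
    have "bounded (D ` {a..b})" by (intro compact_imp_bounded compact_continuous_image cD compact_Icc)
    then obtain B where "0 < B" "\<forall>x\<in>D ` {a..b}. norm x \<le> B" unfolding bounded_pos by blast
    then show ?thesis by (intro that[of B]) auto
  qed
  have DB: "norm (D t w) \<le> B * norm w" if "t \<in> {a..b}" for t w
    using norm_blinfun[of "D t" w] mult_right_mono[OF B(2)[OF that], of "norm w"] by auto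
  \<comment> \<open>\<open>V\<close> is the right-hand side of the variational equation, affine in \<open>X\<close>\<close>
  define V where "V t X = ((D t o\<^sub>L inl) o\<^sub>L X) + (D t o\<^sub>L inr)" for t and X :: "'z \<Rightarrow>\<^sub>L 'e"
  have V: "V t X h = D t (X h, h)" for t X h
    using split[of t "X h" h] by (simp add: V_def blinfun.add_left inl inr)
  have contV: "continuous_on ({a..b} \<times> UNIV) (\<lambda>(t, X). V t X)"
    unfolding split_beta' V_def
    by (intro continuous_intros bounded_bilinear.continuous_on[OF bounded_bilinear_blinfun_compose]
        continuous_on_compose2[OF cD continuous_on_fst]) auto
  have lipV: "norm (V t X - V t Y) \<le> B * norm (X - Y)" if t: "t \<in> {a..b}" for t X Y
  proof (rule norm_blinfun_bound)
    show "0 \<le> B * norm (X - Y)" using B by simp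
    fix h
    have "(V t X - V t Y) h = D t ((X - Y) h, 0)"
      by (simp add: blinfun.diff_left V blinfun.diff_right[symmetric])
    also have "norm \<dots> \<le> B * (norm (X - Y) * norm h)"
      using order_trans[OF DB[OF t, of "((X - Y) h, 0)"]] mult_left_mono[OF norm_blinfun[of "X - Y" h], of B] B(1)
      by (simp add: norm_Pair del: mult_le_cancel_left_pos)
    finally show "norm ((V t X - V t Y) h) \<le> B * norm (X - Y) * norm h" by (simp add: mult.assoc)
  qed
  obtain W where W: "W b = c" "solves_ode_on {a..b} V W"
    by (rule picard_lindelof_terminal[OF ab less_imp_le[OF B(1)] contV lipV])
  have dW: "((\<lambda>t. W t h) has_vector_derivative D t (W t h, h)) (at t within {a..b})" if "t \<in> {a..b}" for t h
    using bounded_linear.has_vector_derivative[OF blinfun.bounded_linear_left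
        W(2)[unfolded solves_ode_on_def, rule_format, OF that], of h]
    by (simp add: V)
  \<comment> \<open>a common bound for the exponential factors in the two applications of Gronwall below\<close>
  define E where "E = exp (B * (b - a)) + exp (max 1 L * (b - a))"
  have E: "exp (B * \<bar>t - b\<bar>) \<le> E" "exp (max 1 L * \<bar>t - b\<bar>) \<le> E" "0 < E" if "t \<in> {a..b}" for t
  proof -
    have le: "exp (M * \<bar>t - b\<bar>) \<le> exp (M * (b - a))" if "0 < M" for M
      using that \<open>t \<in> {a..b}\<close> by auto
    have "0 < exp (B * (b - a))" "0 < exp (max 1 L * (b - a))" by simp_all
    with le[of B] le[of "max 1 L"] B(1)
    show "exp (B * \<bar>t - b\<bar>) \<le> E" "exp (max 1 L * \<bar>t - b\<bar>) \<le> E" "0 < E"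
      unfolding E_def by linarith+
  qed
  have E0: "0 < E" using E(3)[of a] ab by auto
  define K where "K = (norm c + 1 + (B + 1)) * E"
  have at_end: "\<forall>\<^sub>F z in nhds z0. norm (y b z - y0 b - c (z - z0)) \<le> e * norm (z - z0)" if "0 < e" for e
    using terminal that unfolding has_derivative_iff_eventually y0_def by blast
  have lin: "\<exists>d>0. ball z0 d \<subseteq> U \<and> (\<forall>t\<in>{a..b}. \<forall>u v. norm (u, v) < d \<longrightarrow>
       norm (F (y0 t + u) t (z0 + v) - F (y0 t) t z0 - DF (y0 t, t, z0) (u, v)) \<le> e * norm (u, v))"
    if "0 < e" for e
    by (rule uniform_linearization[OF U compact_Icc cy _ cont that]) (erule (1) der, blast)
  have ball: "\<forall>\<^sub>F z in nhds z0. z \<in> ball z0 d" if "0 < d" for d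
    using that by (intro eventually_nhds_in_open) auto
  \<comment> \<open>a first application of Gronwall: \<open>y t z - y t z0\<close> is of order \<open>z - z0\<close>, uniformly in \<open>t\<close>\<close>
  have lip_ev: "\<forall>\<^sub>F z in nhds z0. z \<in> U \<and> (\<forall>t\<in>{a..b}. norm (y t z - y0 t) \<le> K * norm (z - z0))"
  proof -
    obtain d where d: "0 < d" "ball z0 d \<subseteq> U"
      "\<And>t u v. t \<in> {a..b} \<Longrightarrow> norm (u, v) < d \<Longrightarrow>
         norm (F (y0 t + u) t (z0 + v) - F (y0 t) t z0 - DF (y0 t, t, z0) (u, v)) \<le> 1 * norm (u, v)"
      using lin[OF zero_less_one] by blast
    show ?thesis
      using ball[OF d(1)] at_end[OF zero_less_one]
    proof eventually_elim
      case (elim z)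
      then have zU: "z \<in> U" using d(2) by auto
      have zd: "norm (z - z0) < d" using elim(1) by (simp add: dist_norm norm_minus_commute)
      define e where "e = (B + 1) * norm (z - z0)"
      have e: "0 \<le> e" using B by (simp add: e_def)
      have "norm (y t z - y0 t) \<le> K * norm (z - z0)" if t: "t \<in> {a..b}" for t
      proof -
        have "norm (y t z - y0 t) \<le> (norm (y b z - y0 b) + e / max 1 L) * exp (max 1 L * \<bar>t - b\<bar>)"
        proof (rule gronwall[OF _ t _ e])
          fix s assume s: "s \<in> {a..b}"
          show "((\<lambda>t. y t z - y0 t) has_vector_derivative F (y s z) s z - F (y0 s) s z0) (at s within {a..b})"
            using sol[OF zU] sol[OF U(2)] s by (auto simp: solves_ode_on_def y0_def intro!: derivative_intros)
          have "norm (F (y0 s + 0) s (z0 + (z - z0)) - F (y0 s) s z0 - D s (0, z - z0)) \<le> 1 * norm (0::'e, z - z0)"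
            unfolding D_def by (rule d(3)[OF s]) (use zd in simp)
          then have "norm (F (y0 s) s z - F (y0 s) s z0) \<le> norm (z - z0) + norm (D s (0, z - z0))"
            by (simp add: norm_triangle_sub order_trans[OF norm_triangle_sub[of _ "D s (0, z - z0)"]])
          also have "norm (D s (0, z - z0)) \<le> B * norm (z - z0)"
            using DB[OF s, of "(0, z - z0)"] by simp
          finally have 1: "norm (F (y0 s) s z - F (y0 s) s z0) \<le> e"
            by (simp add: e_def algebra_simps)
          have "norm (F (y s z) s z - F (y0 s) s z) \<le> L * norm (y s z - y0 s)" using lip[OF s zU] .
          also have "\<dots> \<le> max 1 L * norm (y s z - y0 s)" by (intro mult_right_mono) auto
          finally show "norm (F (y s z) s z - F (y0 s) s z0) \<le> max 1 L * norm (y s z - y0 s) + e"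
            using 1 norm_triangle_ineq[of "F (y s z) s z - F (y0 s) s z" "F (y0 s) s z - F (y0 s) s z0"] by simp
        qed (use ab in auto)
        also have "\<dots> \<le> (norm (y b z - y0 b) + e) * E"
        proof (intro mult_mono add_left_mono E t)
          show "e / max 1 L \<le> e" using e by (simp add: divide_le_eq mult_le_cancel_left1)
        qed (use e E0 in auto)
        also have "norm (y b z - y0 b) \<le> (norm c + 1) * norm (z - z0)"
        proof -
          have "norm (y b z - y0 b) \<le> norm (y b z - y0 b - c (z - z0)) + norm (c (z - z0))"
            by (metis diff_add_cancel norm_triangle_ineq)
          then show ?thesis using elim(2) norm_blinfun[of c "z - z0"] by (simp add: algebra_simps)
        qed
        finally show ?thesis using E0 by (simp add: K_def e_def algebra_simps)
      qed
      then show ?case using zU by blast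
    qed
  qed
  have K0: "0 \<le> K" using B E0 by (simp add: K_def)
  \<comment> \<open>the error \<open>y t z - y t z0 - W t (z - z0)\<close> solves the variational equation up to the linearization
    remainder of \<open>F\<close>, which by the first bound is \<open>o(norm (z - z0))\<close>; Gronwall carries this over to the error\<close>
  have main: "\<forall>\<^sub>F z in nhds z0. \<forall>t\<in>{a..b}. norm (y t z - y0 t - W t (z - z0)) \<le> e * norm (z - z0)" if e: "0 < e" for e
  proof -
    \<comment> \<open>chosen so that \<open>(e1 + e2 * (K + 1) / B) * E = e\<close>, the bound that Gronwall yields\<close>
    define e1 where "e1 = e / (2 * E)"
    define e2 where "e2 = e * B / (2 * E * (K + 1))"
    have e12: "0 < e1" "0 < e2" using e E0 B K0 by (auto simp: e1_def e2_def)
    obtain d where d: "0 < d" "ball z0 d \<subseteq> U"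
      "\<And>t u v. t \<in> {a..b} \<Longrightarrow> norm (u, v) < d \<Longrightarrow>
         norm (F (y0 t + u) t (z0 + v) - F (y0 t) t z0 - DF (y0 t, t, z0) (u, v)) \<le> e2 * norm (u, v)"
      using lin[OF e12(2)] by blast
    have "0 < d / (K + 1)" using d K0 by simp
    from ball[OF this] lip_ev at_end[OF e12(1)] show ?thesis
    proof eventually_elim
      case (elim z)
      then have zU: "z \<in> U" and lz: "\<And>t. t \<in> {a..b} \<Longrightarrow> norm (y t z - y0 t) \<le> K * norm (z - z0)" by auto
      have zd: "(K + 1) * norm (z - z0) < d"
        using elim(1) K0 by (simp add: dist_norm norm_minus_commute field_simps)
      define r where "r = e2 * ((K + 1) * norm (z - z0))"
      have r: "0 \<le> r" using e12 K0 by (simp add: r_def)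
      show ?case
      proof
        fix t assume t: "t \<in> {a..b}"
        have "norm (y t z - y0 t - W t (z - z0)) \<le> (norm (y b z - y0 b - W b (z - z0)) + r / B) * exp (B * \<bar>t - b\<bar>)"
        proof (rule gronwall[OF _ t B(1) r])
          fix s assume s: "s \<in> {a..b}"
          show "((\<lambda>t. y t z - y0 t - W t (z - z0)) has_vector_derivative
              F (y s z) s z - F (y0 s) s z0 - D s (W s (z - z0), z - z0)) (at s within {a..b})"
            using sol[OF zU] sol[OF U(2)] dW[OF s] s
            by (auto simp: solves_ode_on_def y0_def intro!: derivative_intros)
          have n: "norm (y s z - y0 s, z - z0) \<le> (K + 1) * norm (z - z0)"
            using norm_Pair_le[of "y s z - y0 s" "z - z0"] lz[OF s] by (simp add: algebra_simps)
          have "norm (F (y0 s + (y s z - y0 s)) s (z0 + (z - z0)) - F (y0 s) s z0 - D s (y s z - y0 s, z - z0))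
              \<le> e2 * norm (y s z - y0 s, z - z0)"
            unfolding D_def by (rule d(3)[OF s]) (use n zd in linarith)
          also have "\<dots> \<le> r" unfolding r_def using n e12 by (intro mult_left_mono) auto
          finally have 1: "norm (F (y s z) s z - F (y0 s) s z0 - D s (y s z - y0 s, z - z0)) \<le> r" by simp
          have "D s (y s z - y0 s, z - z0) = D s (y s z - y0 s - W s (z - z0), 0) + D s (W s (z - z0), z - z0)"
            by (simp add: blinfun.add_right[symmetric])
          then have "F (y s z) s z - F (y0 s) s z0 - D s (W s (z - z0), z - z0)
              = D s (y s z - y0 s - W s (z - z0), 0) + (F (y s z) s z - F (y0 s) s z0 - D s (y s z - y0 s, z - z0))"
            by simp
          moreover have "norm (D s (y s z - y0 s - W s (z - z0), 0)) \<le> B * norm (y s z - y0 s - W s (z - z0))"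
            using DB[OF s, of "(y s z - y0 s - W s (z - z0), 0)"] by simp
          ultimately show "norm (F (y s z) s z - F (y0 s) s z0 - D s (W s (z - z0), z - z0))
              \<le> B * norm (y s z - y0 s - W s (z - z0)) + r"
            using 1 norm_triangle_le add_mono by metis
        qed (use ab in auto)
        also have "\<dots> \<le> (e1 * norm (z - z0) + r / B) * E"
          using elim(3) e12 r B E0 E[OF t] by (intro mult_mono add_right_mono) (auto simp: W(1))
        also have "\<dots> = e * norm (z - z0)"
        proof -
          have "r / B = e * norm (z - z0) / (2 * E)"
            unfolding r_def e2_def using K0 B(1) by simp
          then show ?thesis using E0 by (simp add: e1_def field_simps)
        qed
        finally show "norm (y t z - y0 t - W t (z - z0)) \<le> e * norm (z - z0)" .
      qed
    qed
  qed
  have dy: "(y t has_derivative blinfun_apply (W t)) (at z0)" if t: "t \<in> {a..b}" for t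
    unfolding has_derivative_iff_eventually
  proof (intro conjI allI impI blinfun.bounded_linear_right)
    fix e :: real assume "0 < e"
    from main[OF this] show "\<forall>\<^sub>F z in nhds z0. norm (y t z - y t z0 - W t (z - z0)) \<le> e * norm (z - z0)"
      by eventually_elim (use t in \<open>auto simp: y0_def\<close>)
  qed
  show thesis
    by (rule that[of W K]) (use W(1) dy dW lip_ev in \<open>auto simp: D_def y0_def\<close>)
qed

section \<open>Differentiation under the integral sign\<close>

text \<open>Differentiation under the integral sign. Neither \<open>k\<close> nor \<open>k'\<close> is assumed continuous in \<open>t\<close>;
  measurability of \<open>k' t v\<close> in \<open>t\<close> comes from its being a limit of difference quotients, and
  domination from the Lipschitz bound at \<open>z0\<close>.\<close>

lemma has_derivative_integral_dominated:
  fixes k :: "real \<Rightarrow> 'z::real_normed_vector \<Rightarrow> real"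
  assumes ab: "a \<le> b"
    and int: "\<forall>\<^sub>F z in nhds z0. (\<lambda>t. k t z) integrable_on {a..b}"
    and der: "\<And>t. t \<in> {a..b} \<Longrightarrow> (k t has_derivative k' t) (at z0)"
    and lip: "\<forall>\<^sub>F z in nhds z0. \<forall>t\<in>{a..b}. \<bar>k t z - k t z0\<bar> \<le> C * norm (z - z0)"
  shows "(\<lambda>t. k' t v) absolutely_integrable_on {a..b}"
    and "((\<lambda>z. integral {a..b} (\<lambda>t. k t z)) has_derivative (\<lambda>v. integral {a..b} (\<lambda>t. k' t v))) (at z0)"
proof -
  obtain d where d: "0 < d"
    "\<And>z. dist z z0 < d \<Longrightarrow> (\<lambda>t. k t z) integrable_on {a..b}"
    "\<And>z t. dist z z0 < d \<Longrightarrow> t \<in> {a..b} \<Longrightarrow> \<bar>k t z - k t z0\<bar> \<le> C * norm (z - z0)"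
    using eventually_conj[OF int lip] unfolding eventually_nhds_metric by blast
  have int0: "(\<lambda>t. k t z0) integrable_on {a..b}" using d(2)[of z0] d(1) by simp
  have k': "(\<lambda>t. k' t v) integrable_on {a..b} \<and> (\<forall>t\<in>{a..b}. \<bar>k' t v\<bar> \<le> C * norm v)" for v
  proof (cases "v = 0")
    case True
    have "k' t v = 0" if "t \<in> {a..b}" for t
      using linear_0[OF has_derivative_linear[OF der[OF that]]] True by simp
    then show ?thesis using True integrable_eq[OF integrable_0[of "{a..b}"], of "\<lambda>t. k' t v"] by simp
  next
    case False
    \<comment> \<open>steps \<open>h n\<close> tending to 0 with \<open>z0 + h n *\<^sub>R v\<close> inside the ball of radius \<open>d\<close>\<close>
    define h where "h n = d / norm v / real (n + 2)" for n
    have h: "0 < h n" "norm (h n *\<^sub>R v) < d" for n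
    proof -
      show "0 < h n" unfolding h_def using d(1) False by (intro divide_pos_pos) auto
      then have "norm (h n *\<^sub>R v) = d / real (n + 2)" using False d(1) by (simp add: h_def)
      also have "\<dots> < d" using d(1) by (simp add: divide_less_eq)
      finally show "norm (h n *\<^sub>R v) < d" .
    qed
    have dz: "dist (z0 + h n *\<^sub>R v) z0 < d" for n using h(2)[of n] by (simp add: dist_norm)
    define q where "q n t = (k t (z0 + h n *\<^sub>R v) - k t z0) / h n" for n t
    have qi: "q n integrable_on {a..b}" for n
      unfolding q_def by (intro integrable_on_divide integrable_diff d(2)[OF dz] int0)
    have qb: "\<bar>q n t\<bar> \<le> C * norm v" if "t \<in> {a..b}" for n t
      using d(3)[OF dz that, of n] h(1)[of n] by (simp add: q_def field_simps)
    have ql: "(\<lambda>n. q n t) \<longlonglongrightarrow> k' t v" if t: "t \<in> {a..b}" for t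
    proof -
      have "((\<lambda>s. z0 + s *\<^sub>R v) has_derivative (\<lambda>s. s *\<^sub>R v)) (at 0)"
        by (auto intro!: derivative_eq_intros)
      from has_derivative_compose[OF this, of "k t" "k' t"] der[OF t]
      have "((\<lambda>s. k t (z0 + s *\<^sub>R v)) has_derivative (\<lambda>s. k' t (s *\<^sub>R v))) (at 0)" by simp
      moreover have "(\<lambda>s. k' t (s *\<^sub>R v)) = (*) (k' t v)"
        using linear_scale[OF has_derivative_linear[OF der[OF t]]] by (auto simp: mult.commute)
      ultimately have "((\<lambda>s. (k t (z0 + s *\<^sub>R v) - k t z0) / s) \<longlongrightarrow> k' t v) (at 0)"
        by (simp add: has_field_derivative_iff[symmetric] has_field_derivative_def)
          (simp add: has_field_derivative_def[symmetric] has_field_derivative_iff)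
      moreover have "filterlim h (at 0) sequentially"
      proof -
        have "h \<longlonglongrightarrow> 0" unfolding h_def[abs_def]
          by (intro LIMSEQ_ignore_initial_segment[where f = "\<lambda>n. d / norm v / real n"] lim_const_over_n)
        moreover have "\<forall>\<^sub>F n in sequentially. h n \<noteq> 0" using h(1) by (intro always_eventually) (metis less_irrefl)
        ultimately show ?thesis unfolding filterlim_at by auto
      qed
      ultimately show ?thesis unfolding q_def by (rule filterlim_compose)
    qed
    have "(\<lambda>t. k' t v) integrable_on {a..b}"
      by (rule dominated_convergence(1)[of q, OF qi, of "\<lambda>t. C * norm v"])
        (use qb ql in \<open>auto intro: integrable_const_ivl\<close>)
    moreover have "\<bar>k' t v\<bar> \<le> C * norm v" if "t \<in> {a..b}" for t
      by (rule LIMSEQ_le_const2[OF tendsto_rabs[OF ql[OF that]]]) (use qb that in auto)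
    ultimately show ?thesis by blast
  qed
  have k'_int: "(\<lambda>t. k' t v) integrable_on {a..b}" for v using k' by blast
  have k'_bound: "\<bar>k' t v\<bar> \<le> C * norm v" if "t \<in> {a..b}" for t v using k' that by blast
  show "(\<lambda>t. k' t v) absolutely_integrable_on {a..b}"
    by (rule absolutely_integrable_integrable_bound[where g = "\<lambda>t. C * norm v"])
       (use k'_int k'_bound in auto)
  have lin: "linear (k' t)" if "t \<in> {a..b}" for t using der[OF that] has_derivative_linear by blast
  show "((\<lambda>z. integral {a..b} (\<lambda>t. k t z)) has_derivative (\<lambda>v. integral {a..b} (\<lambda>t. k' t v))) (at z0)"
    unfolding has_derivative_at2
  proof
    show "bounded_linear (\<lambda>v. integral {a..b} (\<lambda>t. k' t v))"
    proof (rule bounded_linear_intro)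
      show "integral {a..b} (\<lambda>t. k' t (u + v)) = integral {a..b} (\<lambda>t. k' t u) + integral {a..b} (\<lambda>t. k' t v)" for u v
        by (subst integral_add[OF k'_int k'_int, symmetric]) (auto intro!: integral_cong linear_add lin)
      show "integral {a..b} (\<lambda>t. k' t (r *\<^sub>R v)) = r *\<^sub>R integral {a..b} (\<lambda>t. k' t v)" for r v
        unfolding integral_cmul[symmetric] by (intro integral_cong linear_scale lin)
      show "norm (integral {a..b} (\<lambda>t. k' t v)) \<le> norm v * (C * (b - a))" for v
        using integral_norm_bound_integral[OF k'_int[of v], of "\<lambda>t. C * norm v"] k'_bound[of _ v] ab
        by (simp add: mult_ac integrable_const_ivl)
    qed
    show "(\<lambda>z. (1 / norm (z - z0)) *\<^sub>R (integral {a..b} (\<lambda>t. k t z) -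
        (integral {a..b} (\<lambda>t. k t z0) + integral {a..b} (\<lambda>t. k' t (z - z0))))) \<midarrow>z0\<rightarrow> 0"
      unfolding tendsto_at_iff_sequentially o_def
    proof (intro allI impI)
      fix X assume X: "\<forall>i. X i \<in> UNIV - {z0}" "X \<longlonglongrightarrow> z0"
      then obtain N where N: "\<And>n. N \<le> n \<Longrightarrow> dist (X n) z0 < d" using metric_LIMSEQ_D d(1) by blast
      define Y where "Y n = X (n + N)" for n
      have Y: "Y n \<noteq> z0" "dist (Y n) z0 < d" for n using X N by (auto simp: Y_def)
      define g where "g n t = (1 / norm (Y n - z0)) *\<^sub>R (k t (Y n) - (k t z0 + k' t (Y n - z0)))" for n t
      have gi: "(1 / norm (Y n - z0)) *\<^sub>R (integral {a..b} (\<lambda>t. k t (Y n)) -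
        (integral {a..b} (\<lambda>t. k t z0) + integral {a..b} (\<lambda>t. k' t (Y n - z0)))) = integral {a..b} (g n)" for n
        unfolding g_def
        by (simp add: integral_diff integral_add integrable_add d(2)[OF Y(2)] int0 k'_int)
      have "(\<lambda>n. integral {a..b} (g n)) \<longlonglongrightarrow> integral {a..b} (\<lambda>t. 0)"
      proof (rule dominated_convergence(2)[where h = "\<lambda>t. 2 * C"])
        show "g n integrable_on {a..b}" for n unfolding g_def
          by (intro integrable_cmul integrable_diff integrable_add d(2)[OF Y(2)] int0 k'_int)
        show "(\<lambda>t. 2 * C) integrable_on {a..b}" by (rule integrable_const_ivl)
        fix t assume t: "t \<in> {a..b}"
        show "norm (g n t) \<le> 2 * C" for n
        proof -
          have "\<bar>k t (Y n) - (k t z0 + k' t (Y n - z0))\<bar> \<le> 2 * C * norm (Y n - z0)"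
            using d(3)[OF Y(2) t, of n] k'_bound[OF t, of "Y n - z0"] by linarith
          then show ?thesis using Y(1)[of n] by (simp add: g_def abs_mult field_simps)
        qed
        have "Y \<longlonglongrightarrow> z0" unfolding Y_def[abs_def] by (rule LIMSEQ_ignore_initial_segment[OF X(2)])
        moreover have "\<forall>i. Y i \<in> UNIV - {z0}" using Y by auto
        ultimately show "(\<lambda>n. g n t) \<longlonglongrightarrow> 0"
          using der[OF t] unfolding has_derivative_at2 tendsto_at_iff_sequentially o_def g_def by blast
      qed
      then have "(\<lambda>n. integral {a..b} (g n)) \<longlonglongrightarrow> 0" by simp
      then show "(\<lambda>n. (1 / norm (X n - z0)) *\<^sub>R (integral {a..b} (\<lambda>t. k t (X n)) -
        (integral {a..b} (\<lambda>t. k t z0) + integral {a..b} (\<lambda>t. k' t (X n - z0))))) \<longlonglongrightarrow> 0"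
        unfolding gi[symmetric] Y_def by (rule LIMSEQ_offset)
    qed
  qed
qed

section \<open>Liouville's formula for determinants\<close>

lemma has_derivative_det:
  fixes M :: "real \<Rightarrow> real^'n^'n"
  assumes der: "\<And>i j. ((\<lambda>t. M t $ i $ j) has_real_derivative M' $ i $ j) (at t within S)"
  shows "((\<lambda>t. det (M t)) has_real_derivative
            (\<Sum>i\<in>UNIV. det (\<chi> k. if k = i then M' $ k else M t $ k))) (at t within S)"
proof -
  let ?P = "{p. p permutes (UNIV :: 'n set)}"
  let ?sg = "\<lambda>p. of_int (sign p) :: real"
  have "((\<lambda>t. \<Sum>p\<in>?P. ?sg p * (\<Prod>i\<in>UNIV. M t $ i $ p i)) has_real_derivative
      (\<Sum>p\<in>?P. ?sg p * (\<Sum>i\<in>UNIV. M' $ i $ p i * (\<Prod>j\<in>UNIV - {i}. M t $ j $ p j)))) (at t within S)"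
  proof (intro DERIV_sum DERIV_cmult)
    fix p
    have "(\<lambda>y. \<Sum>i\<in>UNIV. M' $ i $ p i * y * (\<Prod>j\<in>UNIV - {i}. M t $ j $ p j))
        = (*) (\<Sum>i\<in>UNIV. M' $ i $ p i * (\<Prod>j\<in>UNIV - {i}. M t $ j $ p j))"
      by (rule ext) (simp add: sum_distrib_left mult_ac)
    then show "((\<lambda>t. \<Prod>i\<in>UNIV. M t $ i $ p i) has_real_derivative
        (\<Sum>i\<in>UNIV. M' $ i $ p i * (\<Prod>j\<in>UNIV - {i}. M t $ j $ p j))) (at t within S)"
      using has_derivative_prod[of UNIV "\<lambda>i t. M t $ i $ p i" "\<lambda>i. (*) (M' $ i $ p i)" t S] der
      by (simp add: has_field_derivative_def)
  qed
  also have "(\<Sum>p\<in>?P. ?sg p * (\<Sum>i\<in>UNIV. M' $ i $ p i * (\<Prod>j\<in>UNIV - {i}. M t $ j $ p j)))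
      = (\<Sum>i\<in>UNIV. \<Sum>p\<in>?P. ?sg p * (M' $ i $ p i * (\<Prod>j\<in>UNIV - {i}. M t $ j $ p j)))"
    unfolding sum_distrib_left by (rule sum.swap)
  also have "\<dots> = (\<Sum>i\<in>UNIV. det (\<chi> k. if k = i then M' $ k else M t $ k))"
  proof (rule sum.cong[OF refl])
    fix i
    have "M' $ i $ p i * (\<Prod>j\<in>UNIV - {i}. M t $ j $ p j) =
        (\<Prod>j\<in>UNIV. (\<chi> k. if k = i then M' $ k else M t $ k) $ j $ p j)" for p
      by (subst prod.remove[of UNIV i]) auto
    then show "(\<Sum>p\<in>?P. ?sg p * (M' $ i $ p i * (\<Prod>j\<in>UNIV - {i}. M t $ j $ p j))) =
        det (\<chi> k. if k = i then M' $ k else M t $ k)"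
      by (simp add: det_def)
  qed
  finally show ?thesis by (simp add: det_def[abs_def])
qed

text \<open>Liouville's formula: along a linear equation \<open>M' = A ** M\<close> the determinant grows at the rate
  \<open>trace A\<close>.\<close>

lemma liouville_det:
  fixes M :: "real \<Rightarrow> real^'n^'n"
  assumes der: "\<And>i j. ((\<lambda>t. M t $ i $ j) has_real_derivative (A ** M t) $ i $ j) (at t within S)"
  shows "((\<lambda>t. det (M t)) has_real_derivative trace A * det (M t)) (at t within S)"
proof -
  have "det (\<chi> k. if k = i then (A ** M t) $ k else M t $ k) = A $ i $ i * det (M t)" for i
  proof -
    have "(A ** M t) $ i = (\<Sum>l\<in>UNIV. A $ i $ l *s M t $ l)"
      by (simp add: vec_eq_iff matrix_matrix_mult_def)
    then have "det (\<chi> k. if k = i then (A ** M t) $ k else M t $ k)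
        = det (\<chi> k. if k = i then (\<Sum>l\<in>UNIV. A $ i $ l *s M t $ l) else M t $ k)"
      by (intro arg_cong[where f = det]) (simp add: vec_eq_iff)
    also have "\<dots> = (\<Sum>l\<in>UNIV. A $ i $ l * det (\<chi> k. if k = i then M t $ l else M t $ k))"
      by (simp add: det_linear_row_sum det_row_mul)
    also have "\<dots> = (\<Sum>l\<in>UNIV. if l = i then A $ i $ i * det (M t) else 0)"
    proof (rule sum.cong[OF refl])
      fix l
      have "det (\<chi> k. if k = i then M t $ l else M t $ k) = 0" if "l \<noteq> i"
        by (rule det_identical_rows[of i l]) (use that in \<open>auto simp: row_def\<close>)
      moreover have "(\<chi> k. if k = i then M t $ i else M t $ k) = M t"
        by (simp add: vec_eq_iff)
      ultimately show "A $ i $ l * det (\<chi> k. if k = i then M t $ l else M t $ k)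
          = (if l = i then A $ i $ i * det (M t) else 0)"
        by auto
    qed
    finally show ?thesis by simp
  qed
  then show ?thesis
    using has_derivative_det[OF der] by (simp add: trace_def sum_distrib_right)
qed

section \<open>Change of variables for densities\<close>

text \<open>For a bijection \<open>g\<close> with inverse \<open>\<psi>\<close>, the image of Lebesgue measure under \<open>\<psi>\<close> has the
  Jacobian determinant of \<open>g\<close> as its density. Sets of infinite measure are covered too: both sides
  are then infinite, since a set and its integral of \<open>J\<close> are finite together.\<close>

lemma distr_lborel_inverse_diffeo_wellorder:
  fixes g \<psi> :: "real^'n::{finite,wellorder} \<Rightarrow> real^'n::_"
  assumes inv: "\<And>x. \<psi> (g x) = x" "\<And>x. g (\<psi> x) = x"
    and der: "\<And>x. (g has_derivative g' x) (at x)"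
    and J: "J \<in> borel_measurable borel" "\<And>x. \<bar>det (matrix (g' x))\<bar> = J x"
    and \<psi>: "\<psi> \<in> borel_measurable borel"
  shows "distr lborel borel \<psi> = density lborel (\<lambda>x. ennreal (J x))"
proof (rule measure_eqI)
  fix S assume "S \<in> sets (distr lborel borel \<psi>)"
  then have S: "S \<in> sets borel" by simp
  have J0: "0 \<le> J x" for x using J(2)[of x] by simp
  have img: "\<psi> -` S = g ` S"
    by (rule set_eqI) (metis inv image_iff vimage_eq)
  have gS: "g ` S \<in> sets borel" using measurable_sets[OF \<psi> S] by (simp add: img)
  have inj: "inj_on g S" using inv(1) by (metis inj_onI)
  have lebS: "S \<in> sets lebesgue" using S by (simp add: sets_completionI_sets)
  have d: "(g has_derivative g' x) (at x within S)" if "x \<in> S" for x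
    using der has_derivative_at_withinI by blast
  have iff: "g ` S \<in> lmeasurable \<longleftrightarrow> J integrable_on S"
    using measurable_differentiable_image_eq[OF lebS d inj] by (simp add: J(2))
  have Jm: "(\<lambda>x. indicator S x * J x) \<in> borel_measurable borel" using J(1) S by measurable
  have J_UNIV: "(\<lambda>x. indicator S x * J x) = (\<lambda>x. if x \<in> S then J x else 0)"
    by (auto simp: indicator_def)
  have em: "emeasure (density lborel (\<lambda>x. ennreal (J x))) S = (\<integral>\<^sup>+x. ennreal (indicator S x * J x) \<partial>lborel)"
    using J(1) S by (subst emeasure_density) (auto intro!: nn_integral_cong split: split_indicator)
  have "emeasure lborel (g ` S) = (\<integral>\<^sup>+x. ennreal (indicator S x * J x) \<partial>lborel)"
  proof (cases "J integrable_on S")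
    case True
    have "(J has_integral measure lebesgue (g ` S)) S"
      using measure_differentiable_image_eq[OF lebS d inj] True by (simp add: J(2) has_integral_iff)
    then have "((\<lambda>x. indicator S x * J x) has_integral measure lebesgue (g ` S)) UNIV"
      unfolding J_UNIV has_integral_restrict_UNIV .
    then have "(\<integral>\<^sup>+x. ennreal (indicator S x * J x) \<partial>lborel) = ennreal (measure lebesgue (g ` S))"
      by (intro nn_integral_has_integral_lborel[OF Jm]) (use J0 in auto)
    also have "\<dots> = emeasure lebesgue (g ` S)"
      using iff True by (intro emeasure_eq_measure2[symmetric]) (auto simp: fmeasurable_def)
    also have "\<dots> = emeasure lborel (g ` S)" using gS by simp
    finally show ?thesis by simp
  next
    case False
    have "\<not> (\<integral>\<^sup>+x. ennreal (indicator S x * J x) \<partial>lborel) < \<infinity>"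
    proof
      assume "(\<integral>\<^sup>+x. ennreal (indicator S x * J x) \<partial>lborel) < \<infinity>"
      then have "(\<lambda>x. indicator S x * J x) integrable_on UNIV"
        by (intro nn_integral_integrable_on[OF Jm]) (use J0 in auto)
      then show False using False unfolding J_UNIV integrable_restrict_UNIV by simp
    qed
    moreover have "\<not> emeasure lebesgue (g ` S) < \<infinity>"
      using iff False gS by (auto simp: fmeasurable_def sets_completionI_sets)
    ultimately show ?thesis using gS by (simp add: less_top[symmetric])
  qed
  then show "emeasure (distr lborel borel \<psi>) S = emeasure (density lborel (\<lambda>x. ennreal (J x))) S"
    unfolding em using \<psi> S by (simp add: emeasure_distr img)
qed simp

text \<open>The change of variables formula behind the previous lemma is tied to index types that carry a
  well-order, whereas the coordinates here are indexed by an arbitrary finite type. The type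
  \<open>'n ordered\<close> is a copy of \<open>'n\<close>, well-ordered by an arbitrary enumeration.\<close>

typedef 'n ordered = "UNIV :: 'n set" morphisms of_ordered to_ordered ..

lemma bij_of_ordered: "bij (of_ordered :: 'n ordered \<Rightarrow> 'n)"
  by (metis bijI' of_ordered_inject of_ordered_inverse to_ordered_inverse UNIV_I)

lemma UNIV_ordered: "(UNIV :: 'n ordered set) = to_ordered ` UNIV"
  by (metis of_ordered_inverse surj_def)

instance ordered :: (finite) finite
  by standard (simp add: UNIV_ordered)

text \<open>The position of an index in the enumeration; which injection is chosen does not matter.\<close>

definition ordered_rank :: "'n::finite ordered \<Rightarrow> nat" where
  "ordered_rank = (SOME f. inj f)"

lemma inj_ordered_rank: "inj (ordered_rank :: 'a::finite ordered \<Rightarrow> nat)"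
proof -
  have "finite (UNIV :: 'a ordered set)" by simp
  then obtain f :: "'a ordered \<Rightarrow> nat" where "inj f" using finite_imp_inj_to_nat_seg by blast
  then show ?thesis unfolding ordered_rank_def by (rule someI[where P = inj])
qed

instantiation ordered :: (finite) wellorder
begin

definition less_eq_ordered :: "'a ordered \<Rightarrow> 'a ordered \<Rightarrow> bool" where
  "less_eq_ordered x y \<longleftrightarrow> ordered_rank x \<le> ordered_rank y"

definition less_ordered :: "'a ordered \<Rightarrow> 'a ordered \<Rightarrow> bool" where
  "less_ordered x y \<longleftrightarrow> ordered_rank x < ordered_rank y"

instance
proof
  fix P :: "'a ordered \<Rightarrow> bool" and a :: "'a ordered"
  assume "\<And>x. (\<And>y. y < x \<Longrightarrow> P y) \<Longrightarrow> P x"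
  then show "P a" unfolding less_ordered_def using measure_induct_rule[of ordered_rank P a] by blast
qed (auto simp: less_eq_ordered_def less_ordered_def dest: injD[OF inj_ordered_rank])

end

text \<open>Relabelling of the coordinates by the ordered copy of the index type, and its inverse.\<close>

definition reindex :: "real^'n \<Rightarrow> real^('n ordered)" where
  "reindex x = (\<chi> i. x $ of_ordered i)"

definition unindex :: "real^('n ordered) \<Rightarrow> real^'n" where
  "unindex y = (\<chi> i. y $ to_ordered i)"

lemma unindex_reindex [simp]: "unindex (reindex x) = x"
  and reindex_unindex [simp]: "reindex (unindex y) = y"
  by (simp_all add: reindex_def unindex_def vec_eq_iff of_ordered_inverse to_ordered_inverse)

lemma linear_reindex: "linear (reindex :: real^'n \<Rightarrow> _)"
  by (rule linearI) (simp_all add: reindex_def vec_eq_iff)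

lemma linear_unindex: "linear (unindex :: _ \<Rightarrow> real^'n)"
  by (rule linearI) (simp_all add: unindex_def vec_eq_iff)

lemma reindex_measurable [measurable]: "(reindex :: real^'n \<Rightarrow> _) \<in> borel_measurable borel"
  by (intro borel_measurable_continuous_onI linear_continuous_on) (simp add: linear_conv_bounded_linear[symmetric] linear_reindex)

lemma unindex_measurable [measurable]: "(unindex :: _ \<Rightarrow> real^'n) \<in> borel_measurable borel"
  by (intro borel_measurable_continuous_onI linear_continuous_on) (simp add: linear_conv_bounded_linear[symmetric] linear_unindex)

lemma prod_Basis_cart: "(\<Prod>b\<in>(Basis :: (real^'n) set). f b) = (\<Prod>i\<in>UNIV. f (axis i (1::real) :: real^'n))"
proof -
  have B: "(Basis :: (real^'n) set) = range (\<lambda>i. axis i 1)" by (auto simp: Basis_vec_def)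
  have I: "inj (\<lambda>i::'n. axis i (1::real))" by (auto simp: inj_def axis_eq_axis)
  show ?thesis unfolding B prod.reindex[OF I] o_def ..
qed

text \<open>Relabelling coordinates maps boxes to boxes of the same volume, hence preserves Lebesgue measure.\<close>

lemma distr_lborel_unindex: "distr lborel borel unindex = (lborel :: (real^'n) measure)"
proof (rule lborel_eqI[symmetric])
  fix l u :: "real^'n" assume "\<And>b. b \<in> Basis \<Longrightarrow> l \<bullet> b \<le> u \<bullet> b"
  then have "l \<bullet> axis i 1 \<le> u \<bullet> axis i 1" for i
    by (simp add: axis_in_Basis_iff)
  then have le: "l $ i \<le> u $ i" for i
    by (simp add: inner_axis)
  have "unindex -` box l u = box (reindex l) (reindex u)"
  proof -
    have "(\<forall>i. l $ i < y $ to_ordered i \<and> y $ to_ordered i < u $ i) \<longleftrightarrow>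
        (\<forall>i. l $ of_ordered i < y $ i \<and> y $ i < u $ of_ordered i)" for y :: "real^('n ordered)"
      by (metis of_ordered_inverse to_ordered_inverse UNIV_I)
    then show ?thesis by (auto simp: mem_box_cart reindex_def unindex_def)
  qed
  then have "emeasure (distr lborel borel unindex) (box l u) = emeasure lborel (box (reindex l) (reindex u))"
    by (simp add: emeasure_distr)
  also have "\<dots> = (\<Prod>b\<in>Basis. (reindex u - reindex l) \<bullet> b)"
    by (rule emeasure_lborel_box) (auto simp: Basis_vec_def inner_axis reindex_def le)
  also have "(\<Prod>b\<in>Basis. (reindex u - reindex l) \<bullet> b) = (\<Prod>i\<in>UNIV. (u - l) $ of_ordered i)"
    unfolding prod_Basis_cart by (simp add: inner_axis reindex_def)
  also have "\<dots> = (\<Prod>i\<in>UNIV. (u - l) $ i)"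
    using prod.reindex_bij_betw[OF bij_of_ordered, of "\<lambda>i. (u - l) $ i"] by simp
  also have "\<dots> = (\<Prod>b\<in>Basis. (u - l) \<bullet> b)"
    unfolding prod_Basis_cart by (simp add: inner_axis)
  finally show "emeasure (distr lborel borel unindex) (box l u) = (\<Prod>b\<in>Basis. (u - l) \<bullet> b)" .
qed simp

text \<open>The density of an image measure, for an arbitrary finite index type. The determinant is taken
  after relabelling, where \<open>liouville_det\<close> computes it just as well.\<close>

theorem distr_density_inverse_diffeo:
  fixes g \<psi> :: "real^'n \<Rightarrow> real^'n"
  assumes inv: "\<And>x. \<psi> (g x) = x" "\<And>x. g (\<psi> x) = x"
    and der: "\<And>x. (g has_derivative g' x) (at x)"
    and J: "J \<in> borel_measurable borel"
      "\<And>x. \<bar>det (matrix (\<lambda>v. reindex (g' x (unindex v))))\<bar> = J x"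
    and \<psi> [measurable]: "\<psi> \<in> borel_measurable borel"
    and f [measurable]: "f \<in> borel_measurable borel"
  shows "distr (density lborel f) lborel \<psi> = density lborel (\<lambda>x. ennreal (J x) * f (g x))"
proof -
  have [measurable]: "J \<in> borel_measurable borel" by (rule J(1))
  have [measurable]: "g \<in> borel_measurable borel"
    using der by (intro borel_measurable_continuous_onI)
      (auto intro!: has_derivative_continuous simp: continuous_on_eq_continuous_within has_derivative_at_withinI)
  have bl: "bounded_linear (reindex :: real^'n \<Rightarrow> _)" "bounded_linear (unindex :: _ \<Rightarrow> real^'n)"
    by (simp_all add: linear_conv_bounded_linear[symmetric] linear_reindex linear_unindex)
  have "distr lborel borel (\<lambda>y. reindex (\<psi> (unindex y))) = density lborel (\<lambda>y. ennreal (J (unindex y)))"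
  proof (rule distr_lborel_inverse_diffeo_wellorder[where g = "\<lambda>y. reindex (g (unindex y))"
        and g' = "\<lambda>y v. reindex (g' (unindex y) (unindex v))"])
    fix y
    show "((\<lambda>y. reindex (g (unindex y))) has_derivative (\<lambda>v. reindex (g' (unindex y) (unindex v)))) (at y)"
      by (intro bounded_linear.has_derivative[OF bl(1)]
          has_derivative_compose[OF bounded_linear_imp_has_derivative[OF bl(2)] der])
  qed (use inv J in auto)
  then have "distr (distr lborel borel (\<lambda>y. reindex (\<psi> (unindex y)))) borel unindex
      = distr (density lborel (\<lambda>y. ennreal (J (unindex y)))) borel (unindex :: _ \<Rightarrow> real^'n)" by simp
  also have "\<dots> = density (distr lborel borel unindex) (\<lambda>x. ennreal (J x))"
    by (subst density_distr) auto
  also have "distr (distr lborel borel (\<lambda>y. reindex (\<psi> (unindex y)))) borel unindex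
      = distr (distr lborel borel unindex) borel \<psi>"
    by (simp add: distr_distr o_def)
  finally have *: "distr lborel borel \<psi> = density lborel (\<lambda>x. ennreal (J x))"
    by (simp add: distr_lborel_unindex)
  have "density lborel (\<lambda>x. ennreal (J x) * f (g x)) = density (distr lborel borel \<psi>) (\<lambda>x. f (g x))"
    unfolding * by (subst density_density_eq) auto
  also have "\<dots> = distr (density lborel f) borel \<psi>"
    by (subst density_distr) (auto simp: inv)
  also have "\<dots> = distr (density lborel f) lborel \<psi>"
    by (rule distr_cong) auto
  finally show ?thesis by simp
qed

section \<open>Derivatives of the characteristics and of the log-density\<close>

lemma jacobian_eq:
  fixes f :: "real^'n \<Rightarrow> real^'m"
  assumes "(f has_derivative f') (at x)"
  shows "jacobian f (at x) *v v = f' v"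
proof -
  have "frechet_derivative f (at x) = f'" using frechet_derivative_at[OF assms] by simp
  then show ?thesis
    unfolding jacobian_def using matrix_vector_mul(2)[OF has_derivative_linear[OF assms], THEN fun_cong, of v]
    by simp
qed

lemma grad_eq:
  fixes f :: "real^'n \<Rightarrow> real"
  assumes "(f has_derivative f') (at x)"
  shows "grad f x \<bullet> v = f' v"
proof -
  have eq: "frechet_derivative f (at x) = f'" using frechet_derivative_at[OF assms] by simp
  have lin: "linear f'" using assms has_derivative_linear by blast
  have "f' v = f' (\<Sum>i\<in>UNIV. v $ i *\<^sub>R axis i 1)"
    by (subst basis_expansion[of v, symmetric]) (simp add: scalar_mult_eq_scaleR)
  also have "\<dots> = (\<Sum>i\<in>UNIV. v $ i * f' (axis i 1))"
    by (simp add: linear_sum[OF lin] linear_scale[OF lin])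
  finally show ?thesis by (simp add: grad_def inner_vec_def eq mult.commute)
qed

text \<open>The part of the setting that concerns the characteristics: a field that is \<open>C\<^sup>1\<close> and uniformly
  Lipschitz in the state, its divergence, and the backward characteristics \<open>q t Q a\<close> with their
  accumulated log-density \<open>log_rho t Q a\<close>.\<close>

locale characteristic_flow =
  fixes T :: real
    and A :: "(real ^ 'p) set"
    and R :: "real ^ 'd \<Rightarrow> real \<Rightarrow> real ^ 'p \<Rightarrow> real ^ 'd"
    and q :: "real \<Rightarrow> real ^ 'd \<Rightarrow> real ^ 'p \<Rightarrow> real ^ 'd"
    and log_rho :: "real \<Rightarrow> real ^ 'd \<Rightarrow> real ^ 'p \<Rightarrow> real"
  assumes T_pos: "0 < T"
    and A_open: "open A"
    and R_C1: "C1_on (UNIV \<times> {0..T} \<times> A) (\<lambda>(x, t, a). R x t a)"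
    and R_lipschitz: "\<exists>L. \<forall>t\<in>{0..T}. \<forall>a\<in>A. L-lipschitz_on UNIV (\<lambda>x. R x t a)"
    and h_C1: "\<forall>t\<in>{0..T}. C1_on (UNIV \<times> A) (\<lambda>(x, a). div_field R a x t)"
    and h_deriv_bounded:
      "\<forall>B. bounded B \<longrightarrow> (\<exists>C. \<forall>x\<in>B. \<forall>t\<in>{0..T}. \<forall>a\<in>A.
          norm (grad (\<lambda>b. div_field R b x t) a) \<le> C \<and>
          norm (grad (\<lambda>y. div_field R a y t) x) \<le> C)"
    and characteristic: "\<forall>a\<in>A. \<forall>Q. q T Q a = Q \<and>
          solves_ode_on {0..T} (\<lambda>t y. R y t a) (\<lambda>t. q t Q a)"
    and log_density: "\<forall>a\<in>A. \<forall>Q. log_rho T Q a = 0 \<and>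
          solves_ode_on {0..T} (\<lambda>t _. div_field R a (q t Q a) t) (\<lambda>t. log_rho t Q a)"
begin

text \<open>A continuous derivative of the field in state, time and parameter jointly. At the end points of
  the time interval its time component is one-sided; only the state and parameter components are used.\<close>

definition DR :: "((real^'d) \<times> real \<times> (real^'p)) \<Rightarrow> ((real^'d) \<times> real \<times> (real^'p)) \<Rightarrow>\<^sub>L (real^'d)" where
  "DR = (SOME g'. (\<forall>x\<in>UNIV \<times> {0..T} \<times> A.
      ((\<lambda>(x, t, a). R x t a) has_derivative blinfun_apply (g' x)) (at x within UNIV \<times> {0..T} \<times> A))
      \<and> continuous_on (UNIV \<times> {0..T} \<times> A) g')"

lemma DR:
  "\<And>w. w \<in> UNIV \<times> {0..T} \<times> A \<Longrightarrow>
      ((\<lambda>(x, t, a). R x t a) has_derivative blinfun_apply (DR w)) (at w within UNIV \<times> {0..T} \<times> A)"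
  "continuous_on (UNIV \<times> {0..T} \<times> A) DR"
  using someI_ex[OF R_C1[unfolded C1_on_def], folded DR_def] by blast+

lemma R_has_derivative:
  assumes t: "t \<in> {0..T}" and a: "a \<in> A"
  shows "((\<lambda>(x, a). R x t a) has_derivative (\<lambda>(v, u). DR (x, t, a) (v, 0, u))) (at (x, a))"
proof -
  have "((\<lambda>(x, a). (x, t, a)) has_derivative (\<lambda>(v, u). (v, 0, u))) (at (x, a) within UNIV \<times> A)"
    unfolding split_beta' by (auto intro!: derivative_eq_intros)
  moreover have "((\<lambda>(x, t, a). R x t a) has_derivative blinfun_apply (DR (x, t, a)))
      (at ((\<lambda>(x, a). (x, t, a)) (x, a)) within (\<lambda>(x, a). (x, t, a)) ` (UNIV \<times> A))"
    unfolding prod.case by (rule has_derivative_subset[OF DR(1)]) (use t a in auto)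
  ultimately have "((\<lambda>(x, a). R x t a) has_derivative (\<lambda>(v, u). DR (x, t, a) (v, 0, u))) (at (x, a) within UNIV \<times> A)"
    using has_derivative_in_compose by (fastforce simp: split_beta')
  then show ?thesis
    using a at_within_open[of "(x, a)" "UNIV \<times> A"] A_open by (simp add: open_Times)
qed

lemma R_derivative_state:
  assumes t: "t \<in> {0..T}" and a: "a \<in> A"
  shows "jacobian (\<lambda>y. R y t a) (at x) *v v = DR (x, t, a) (v, 0, 0)"
proof (rule jacobian_eq)
  have "((\<lambda>y. (y, a)) has_derivative (\<lambda>v. (v, 0))) (at x)" by (auto intro!: derivative_eq_intros)
  from has_derivative_compose[OF this R_has_derivative[OF assms]]
  show "((\<lambda>y. R y t a) has_derivative (\<lambda>v. DR (x, t, a) (v, 0, 0))) (at x)" by simp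
qed

lemma R_derivative_parameter:
  assumes t: "t \<in> {0..T}" and a: "a \<in> A"
  shows "jacobian (\<lambda>b. R x t b) (at a) *v u = DR (x, t, a) (0, 0, u)"
proof (rule jacobian_eq)
  have "((\<lambda>b. (x, b)) has_derivative (\<lambda>u. (0, u))) (at a)" by (auto intro!: derivative_eq_intros)
  from has_derivative_compose[OF this R_has_derivative[OF assms]]
  show "((\<lambda>b. R x t b) has_derivative (\<lambda>u. DR (x, t, a) (0, 0, u))) (at a)" by simp
qed

lemma R_norm_diff_le:
  "\<exists>L. \<forall>t\<in>{0..T}. \<forall>a\<in>A. \<forall>x y. norm (R x t a - R y t a) \<le> L * norm (x - y)"
  using R_lipschitz unfolding lipschitz_on_def dist_norm by blast

text \<open>Joint differentiability of the backward characteristics in the terminal point and the parameter.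
  Treating \<open>(Q, a)\<close> as a single parameter gives both the sensitivity in \<open>a\<close> and the Jacobian
  of \<open>Q \<mapsto> q 0 Q a\<close> at once.\<close>

lemma characteristic_differentiable:
  assumes a: "a \<in> A"
  obtains W :: "real \<Rightarrow> ((real^'d) \<times> (real^'p)) \<Rightarrow>\<^sub>L (real^'d)" and K :: real where
    "\<And>w u. W T (w, u) = w"
    "\<And>t. t \<in> {0..T} \<Longrightarrow> ((\<lambda>(Q, a). q t Q a) has_derivative blinfun_apply (W t)) (at (Q, a))"
    "\<And>t w u. t \<in> {0..T} \<Longrightarrow> ((\<lambda>t. W t (w, u)) has_vector_derivative
        jacobian (\<lambda>y. R y t a) (at (q t Q a)) *v W t (w, u)
        + jacobian (\<lambda>b. R (q t Q a) t b) (at a) *v u) (at t within {0..T})"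
    "\<forall>\<^sub>F z in nhds (Q, a). snd z \<in> A \<and>
        (\<forall>t\<in>{0..T}. norm (q t (fst z) (snd z) - q t Q a) \<le> K * norm (z - (Q, a)))"
proof -
  define U where "U = (UNIV :: (real^'d) set) \<times> A"
  define \<iota> :: "((real^'d) \<times> ((real^'d) \<times> (real^'p))) \<Rightarrow>\<^sub>L ((real^'d) \<times> real \<times> (real^'p))"
    where "\<iota> = Blinfun (\<lambda>w. (fst w, 0, snd (snd w)))"
  have \<iota>: "\<iota> w = (fst w, 0, snd (snd w))" for w
    unfolding \<iota>_def
    by (subst bounded_linear_Blinfun_apply)
       (intro bounded_linear_Pair bounded_linear_fst bounded_linear_zero
         bounded_linear_compose[OF bounded_linear_snd bounded_linear_snd] | simp)+
  have \<iota>_comp: "blinfun_apply (D o\<^sub>L \<iota>) = (\<lambda>w. D (fst w, 0, snd (snd w)))" for D :: "_ \<Rightarrow>\<^sub>L (real^'d)"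
    by (rule ext) (simp add: \<iota>)
  define c :: "((real^'d) \<times> (real^'p)) \<Rightarrow>\<^sub>L (real^'d)" where "c = Blinfun fst"
  have c: "c w = fst w" for w
    unfolding c_def by (simp add: bounded_linear_Blinfun_apply[OF bounded_linear_fst])
  define DF :: "(real^'d) \<times> real \<times> ((real^'d) \<times> (real^'p)) \<Rightarrow> _" where "DF = (\<lambda>(x, t, z). DR (x, t, snd z) o\<^sub>L \<iota>)"
  obtain L where L: "\<And>x y t a. t \<in> {0..T} \<Longrightarrow> a \<in> A \<Longrightarrow> norm (R x t a - R y t a) \<le> L * norm (x - y)"
    using R_norm_diff_le by blast
  obtain W K where W: "W T = c"
    "\<And>t. t \<in> {0..T} \<Longrightarrow> ((\<lambda>z. q t (fst z) (snd z)) has_derivative blinfun_apply (W t)) (at (Q, a))"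
    "\<And>t h. t \<in> {0..T} \<Longrightarrow> ((\<lambda>t. W t h) has_vector_derivative
        DF (q t (fst (Q, a)) (snd (Q, a)), t, (Q, a)) (W t h, h)) (at t within {0..T})"
    "\<forall>\<^sub>F z in nhds (Q, a). z \<in> U \<and> (\<forall>t\<in>{0..T}.
        norm (q t (fst z) (snd z) - q t (fst (Q, a)) (snd (Q, a))) \<le> K * norm (z - (Q, a)))"
  proof (rule ode_differentiable_parameter[where F = "\<lambda>x t z. R x t (snd z)" and DF = DF and U = U
        and y = "\<lambda>t z. q t (fst z) (snd z)" and a = 0 and b = T and ?z0.0 = "(Q, a)" and c = c and L = L])
    show "open U" unfolding U_def using A_open by (simp add: open_Times)
    show "(Q, a) \<in> U" using a by (simp add: U_def)
    fix x :: "real^'d" and t and z :: "(real^'d) \<times> (real^'p)" assume t: "t \<in> {0..T}" and z: "z \<in> U"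
    have "((\<lambda>(x, z). (x, snd z)) has_derivative (\<lambda>(v, w). (v, snd w))) (at (x, z))"
      unfolding split_beta' by (auto intro!: derivative_eq_intros)
    from has_derivative_compose[OF this, of "\<lambda>(x, a). R x t a" "\<lambda>(v, u). DR (x, t, snd z) (v, 0, u)"]
      R_has_derivative[OF t, of "snd z" x] z
    show "((\<lambda>(x, z). R x t (snd z)) has_derivative blinfun_apply (DF (x, t, z))) (at (x, z))"
      by (auto simp: DF_def \<iota>_comp U_def split_beta')
  next
    show "continuous_on (UNIV \<times> {0..T} \<times> U) DF"
      unfolding DF_def split_beta' U_def
      by (intro bounded_bilinear.continuous_on[OF bounded_bilinear_blinfun_compose]
          continuous_on_compose2[OF DR(2)] continuous_intros) auto
  next
    fix z assume z: "z \<in> U"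
    then show "solves_ode_on {0..T} (\<lambda>t x. R x t (snd z)) (\<lambda>t. q t (fst z) (snd z))"
      using characteristic by (auto simp: U_def)
    fix x x' t assume t: "t \<in> {0..T}"
    show "norm (R x t (snd z) - R x' t (snd z)) \<le> L * norm (x - x')"
      using L[OF t] z by (auto simp: U_def)
  next
    have "(fst has_derivative blinfun_apply c) (at (Q, a))"
      unfolding c[abs_def] by (auto intro!: derivative_eq_intros)
    moreover have "open (UNIV \<times> A)" "(Q, a) \<in> UNIV \<times> A" using A_open a by (auto intro: open_Times)
    ultimately show "((\<lambda>z. q T (fst z) (snd z)) has_derivative blinfun_apply c) (at (Q, a))"
      using characteristic by (elim has_derivative_transform_within_open) auto
  qed (use T_pos in auto)
  show thesis
  proof (rule that[of W K])
    show "W T (w, u) = w" for w u by (simp add: W(1) c)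
    show "((\<lambda>(Q, a). q t Q a) has_derivative blinfun_apply (W t)) (at (Q, a))" if "t \<in> {0..T}" for t
      using W(2)[OF that] by (simp add: split_beta')
    show "((\<lambda>t. W t (w, u)) has_vector_derivative
        jacobian (\<lambda>y. R y t a) (at (q t Q a)) *v W t (w, u)
        + jacobian (\<lambda>b. R (q t Q a) t b) (at a) *v u) (at t within {0..T})" if t: "t \<in> {0..T}" for t w u
      using W(3)[OF t, of "(w, u)"]
      by (simp add: R_derivative_state[OF t a] R_derivative_parameter[OF t a] blinfun.add_right[symmetric]
          DF_def \<iota>)
    show "\<forall>\<^sub>F z in nhds (Q, a). snd z \<in> A \<and>
        (\<forall>t\<in>{0..T}. norm (q t (fst z) (snd z) - q t Q a) \<le> K * norm (z - (Q, a)))"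
      using W(4) by eventually_elim (auto simp: U_def)
  qed
qed

lemma h_has_derivative:
  assumes t: "t \<in> {0..T}" and a: "a \<in> A"
  shows "((\<lambda>(x, a). div_field R a x t) has_derivative
      (\<lambda>(v, u). grad (\<lambda>y. div_field R a y t) x \<bullet> v + grad (\<lambda>b. div_field R b x t) a \<bullet> u)) (at (x, a))"
proof -
  obtain g' :: "((real^'d) \<times> (real^'p)) \<Rightarrow> ((real^'d) \<times> (real^'p)) \<Rightarrow>\<^sub>L real" where
    "((\<lambda>(x, a). div_field R a x t) has_derivative blinfun_apply (g' (x, a))) (at (x, a) within UNIV \<times> A)"
    using h_C1 t a unfolding C1_on_def by blast
  then have g': "((\<lambda>(x, a). div_field R a x t) has_derivative blinfun_apply (g' (x, a))) (at (x, a))"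
    using a at_within_open[of "(x, a)" "UNIV \<times> A"] A_open by (simp add: open_Times)
  have "((\<lambda>y. (y, a)) has_derivative (\<lambda>v. (v, 0))) (at x)" by (auto intro!: derivative_eq_intros)
  from has_derivative_compose[OF this g']
  have 1: "grad (\<lambda>y. div_field R a y t) x \<bullet> v = g' (x, a) (v, 0)" for v by (intro grad_eq) simp
  have "((\<lambda>b. (x, b)) has_derivative (\<lambda>u. (0, u))) (at a)" by (auto intro!: derivative_eq_intros)
  from has_derivative_compose[OF this g']
  have 2: "grad (\<lambda>b. div_field R b x t) a \<bullet> u = g' (x, a) (0, u)" for u by (intro grad_eq) simp
  have "(\<lambda>(v, u). grad (\<lambda>y. div_field R a y t) x \<bullet> v + grad (\<lambda>b. div_field R b x t) a \<bullet> u) = blinfun_apply (g' (x, a))"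
    by (auto simp: 1 2 blinfun.add_right[symmetric])
  then show ?thesis using g' by simp
qed

text \<open>A Lipschitz bound for the divergence that is uniform in time, from the bounds on its two gradients.\<close>

lemma h_lipschitz_on_bounded:
  assumes "cball a r \<subseteq> A"
  obtains C where "\<And>t (x :: real^'d) (y :: real^'d) b. t \<in> {0..T} \<Longrightarrow> norm x \<le> B \<Longrightarrow> norm y \<le> B \<Longrightarrow> b \<in> cball a r \<Longrightarrow>
      \<bar>div_field R b y t - div_field R a x t\<bar> \<le> C * norm ((y, b) - (x, a))" "0 \<le> C"
proof -
  obtain C0 where C0: "\<forall>x\<in>cball 0 B. \<forall>t\<in>{0..T}. \<forall>a\<in>A.
      norm (grad (\<lambda>b. div_field R b x t) a) \<le> C0 \<and> norm (grad (\<lambda>y. div_field R a y t) x) \<le> C0"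
    using h_deriv_bounded[rule_format, OF bounded_cball[of 0 B]] by (rule exE)
  define C where "C = \<bar>C0\<bar> + \<bar>C0\<bar>"
  show thesis
  proof
    show "0 \<le> C" by (simp add: C_def)
    fix t and x y :: "real^'d" and b assume t: "t \<in> {0..T}" and x: "norm x \<le> B" and y: "norm y \<le> B" and b: "b \<in> cball a r"
    have "norm ((\<lambda>(x, a). div_field R a x t) (y, b) - (\<lambda>(x, a). div_field R a x t) (x, a))
        \<le> C * norm ((y, b) - (x, a))"
    proof (rule differentiable_bound[where S = "cball 0 B \<times> cball a r"])
      show "convex (cball (0::real^'d) B \<times> cball a r)" by (intro convex_Times convex_cball)
      show "(y, b) \<in> cball 0 B \<times> cball a r" using y b by simp
      show "(x, a) \<in> cball 0 B \<times> cball a r" using x b by (simp add: order_trans[OF zero_le_dist])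
      fix w :: "(real^'d) \<times> (real^'p)" assume w: "w \<in> cball 0 B \<times> cball a r"
      have wA: "snd w \<in> A" using w assms by auto
      show "((\<lambda>(x, a). div_field R a x t) has_derivative
        (\<lambda>(v, u). grad (\<lambda>y. div_field R (snd w) y t) (fst w) \<bullet> v + grad (\<lambda>b. div_field R b (fst w) t) (snd w) \<bullet> u))
          (at w within cball 0 B \<times> cball a r)"
        using h_has_derivative[OF t wA, of "fst w"] by (simp add: has_derivative_at_withinI)
      show "onorm (\<lambda>(v, u). grad (\<lambda>y. div_field R (snd w) y t) (fst w) \<bullet> v + grad (\<lambda>b. div_field R b (fst w) t) (snd w) \<bullet> u) \<le> C"
      proof (rule onorm_le)
        fix z :: "(real^'d) \<times> (real^'p)"
        have gr: "norm (grad (\<lambda>b. div_field R b (fst w) t) (snd w)) \<le> \<bar>C0\<bar>"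
          "norm (grad (\<lambda>y. div_field R (snd w) y t) (fst w)) \<le> \<bar>C0\<bar>"
          using C0[rule_format, of "fst w" t "snd w"] t w wA by (auto simp: mem_Times_iff)
        have "\<bar>grad (\<lambda>y. div_field R (snd w) y t) (fst w) \<bullet> fst z\<bar> \<le> \<bar>C0\<bar> * norm z"
          by (rule order_trans[OF Cauchy_Schwarz_ineq2]) (intro mult_mono gr, auto intro: norm_fst_le[of "fst z" "snd z", simplified])
        moreover have "\<bar>grad (\<lambda>b. div_field R b (fst w) t) (snd w) \<bullet> snd z\<bar> \<le> \<bar>C0\<bar> * norm z"
          by (rule order_trans[OF Cauchy_Schwarz_ineq2]) (intro mult_mono gr, auto intro: norm_snd_le[of "snd z" "fst z", simplified])
        ultimately show "norm (case z of (v, u) \<Rightarrow> grad (\<lambda>y. div_field R (snd w) y t) (fst w) \<bullet> v + grad (\<lambda>b. div_field R b (fst w) t) (snd w) \<bullet> u) \<le> C * norm z"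
          by (simp add: C_def split_beta' algebra_simps)
      qed
    qed
    then show "\<bar>div_field R b y t - div_field R a x t\<bar> \<le> C * norm ((y, b) - (x, a))" by simp
  qed
qed

lemma log_rho_eq_integral:
  assumes "a \<in> A"
  shows "((\<lambda>t. div_field R a (q t Q a) t) has_integral - log_rho 0 Q a) {0..T}"
proof -
  have "((\<lambda>t. div_field R a (q t Q a) t) has_integral log_rho T Q a - log_rho 0 Q a) {0..T}"
    using T_pos log_density assms
    by (intro fundamental_theorem_of_calculus) (auto simp: solves_ode_on_def)
  then show ?thesis using log_density assms by simp
qed

text \<open>The derivative of \<open>log_rho 0 Q a\<close>, which is minus the integral of the divergence along the
  characteristic. The divergence is not assumed to be \<open>C\<^sup>1\<close> jointly with time, so this does not
  follow from \<open>ode_differentiable_parameter\<close> for the enlarged system.\<close>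

lemma log_rho_has_derivative:
  assumes a: "a \<in> A" and W:
    "\<And>t. t \<in> {0..T} \<Longrightarrow> ((\<lambda>(Q, a). q t Q a) has_derivative blinfun_apply (W t)) (at (Q, a))"
    "\<forall>\<^sub>F z in nhds (Q, a). snd z \<in> A \<and>
        (\<forall>t\<in>{0..T}. norm (q t (fst z) (snd z) - q t Q a) \<le> K * norm (z - (Q, a)))"
  defines "k' \<equiv> \<lambda>t z. grad (\<lambda>y. div_field R a y t) (q t Q a) \<bullet> W t z
                      + grad (\<lambda>b. div_field R b (q t Q a) t) a \<bullet> snd z"
  shows "(\<lambda>t. k' t z) absolutely_integrable_on {0..T}"
    and "((\<lambda>(Q, a). log_rho 0 Q a) has_derivative (\<lambda>z. - integral {0..T} (\<lambda>t. k' t z))) (at (Q, a))"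
proof -
  define k where "k t z = div_field R (snd z) (q t (fst z) (snd z)) t" for t and z :: "(real^'d) \<times> (real^'p)"
  obtain r where r: "0 < r" "cball a r \<subseteq> A" using A_open a open_contains_cball by blast
  have "continuous_on {0..T} (\<lambda>t. q t Q a)" using characteristic a continuous_on_solution by blast
  then have "bounded ((\<lambda>t. q t Q a) ` {0..T})" by (intro compact_imp_bounded compact_continuous_image compact_Icc)
  then obtain B0 where B0: "\<And>t. t \<in> {0..T} \<Longrightarrow> norm (q t Q a) \<le> B0" unfolding bounded_iff by blast
  obtain C where C: "\<And>t x y b. t \<in> {0..T} \<Longrightarrow> norm x \<le> B0 + \<bar>K\<bar> \<Longrightarrow> norm y \<le> B0 + \<bar>K\<bar> \<Longrightarrow> b \<in> cball a r \<Longrightarrow>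
      \<bar>div_field R b y t - div_field R a x t\<bar> \<le> C * norm ((y, b) - (x, a))" "0 \<le> C"
    using h_lipschitz_on_bounded[OF r(2), of "B0 + \<bar>K\<bar>"] by metis
  have near: "\<forall>\<^sub>F z in nhds (Q, a). z \<in> ball (Q, a) (min 1 r)"
    using r by (intro eventually_nhds_in_open) auto
  have 1: "\<forall>\<^sub>F z in nhds (Q, a). (\<lambda>t. k t z) integrable_on {0..T}"
    using W(2)
  proof eventually_elim
    case (elim z)
    then show ?case unfolding k_def using log_rho_eq_integral[of "snd z" "fst z"] by blast
  qed
  have 2: "(k t has_derivative k' t) (at (Q, a))" if t: "t \<in> {0..T}" for t
  proof -
    have "((\<lambda>z. (q t (fst z) (snd z), snd z)) has_derivative (\<lambda>z. (W t z, snd z))) (at (Q, a))"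
      using W(1)[OF t] by (auto intro!: derivative_eq_intros simp: split_beta')
    from has_derivative_compose[OF this, of "\<lambda>(x, a). div_field R a x t"
        "\<lambda>(v, u). grad (\<lambda>y. div_field R a y t) (q t Q a) \<bullet> v + grad (\<lambda>b. div_field R b (q t Q a) t) a \<bullet> u"]
      h_has_derivative[OF t a, of "q t Q a"]
    show ?thesis unfolding k_def[abs_def] k'_def by (simp add: split_beta')
  qed
  have 3: "\<forall>\<^sub>F z in nhds (Q, a). \<forall>t\<in>{0..T}. \<bar>k t z - k t (Q, a)\<bar> \<le> (C * (\<bar>K\<bar> + 1)) * norm (z - (Q, a))"
    using W(2) near
  proof eventually_elim
    case (elim z)
    show ?case
    proof
      fix t assume t: "t \<in> {0..T}"
      have d: "norm (z - (Q, a)) < 1" "norm (z - (Q, a)) < r"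
        using elim(2) by (auto simp: dist_norm norm_minus_commute)
      have qz: "norm (q t (fst z) (snd z) - q t Q a) \<le> K * norm (z - (Q, a))" using elim(1) t by blast
      also have "\<dots> \<le> \<bar>K\<bar> * norm (z - (Q, a))" by (intro mult_right_mono) auto
      finally have qz: "norm (q t (fst z) (snd z) - q t Q a) \<le> \<bar>K\<bar> * norm (z - (Q, a))" .
      also have "\<dots> \<le> \<bar>K\<bar> * 1" using d by (intro mult_left_mono) auto
      finally have "norm (q t (fst z) (snd z)) \<le> B0 + \<bar>K\<bar>"
        using B0[OF t] norm_triangle_sub[of "q t (fst z) (snd z)" "q t Q a"] by linarith
      moreover have "norm (snd z - a) \<le> norm (z - (Q, a))"
        using norm_snd_le[of "snd z - a" "fst z - Q"] by (metis fst_conv minus_prod_def snd_conv)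
      moreover have "norm (q t Q a) \<le> B0 + \<bar>K\<bar>" using B0[OF t] by simp
      ultimately have "\<bar>k t z - k t (Q, a)\<bar> \<le> C * norm ((q t (fst z) (snd z), snd z) - (q t Q a, a))"
        unfolding k_def fst_conv snd_conv using d t by (intro C(1)) (auto simp: dist_norm norm_minus_commute)
      also have "norm ((q t (fst z) (snd z), snd z) - (q t Q a, a)) \<le> (\<bar>K\<bar> + 1) * norm (z - (Q, a))"
        using norm_Pair_le[of "q t (fst z) (snd z) - q t Q a" "snd z - a"] qz \<open>norm (snd z - a) \<le> _\<close>
        by (simp add: algebra_simps)
      finally show "\<bar>k t z - k t (Q, a)\<bar> \<le> (C * (\<bar>K\<bar> + 1)) * norm (z - (Q, a))"
        using C(2) by (simp add: mult_left_mono mult.assoc)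
    qed
  qed
  note deriv = has_derivative_integral_dominated[OF less_imp_le[OF T_pos] 1 2 3]
  show "(\<lambda>t. k' t z) absolutely_integrable_on {0..T}" by (rule deriv(1))
  have "((\<lambda>z. - integral {0..T} (\<lambda>t. k t z)) has_derivative (\<lambda>z. - integral {0..T} (\<lambda>t. k' t z))) (at (Q, a))"
    by (intro has_derivative_minus deriv(2))
  moreover have "- integral {0..T} (\<lambda>t. k t z) = (\<lambda>(Q, a). log_rho 0 Q a) z" if "z \<in> UNIV \<times> A" for z
    using integral_unique[OF log_rho_eq_integral[of "snd z" "fst z"]] that
    by (auto simp: k_def split_beta')
  moreover have "open (UNIV \<times> A)" "(Q, a) \<in> UNIV \<times> A" using A_open a by (auto intro: open_Times)
  ultimately show "((\<lambda>(Q, a). log_rho 0 Q a) has_derivative (\<lambda>z. - integral {0..T} (\<lambda>t. k' t z))) (at (Q, a))"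
    by (elim has_derivative_transform_within_open)
qed

text \<open>For \<open>W t\<close> the derivative of \<open>Q \<mapsto> q t Q a\<close>, this is the Jacobian determinant of the backward
  map. By Liouville's formula the determinant at time \<open>t\<close> and \<open>exp (log_rho t Q a)\<close> both grow at the
  rate given by the divergence along the characteristic, and both are 1 at time \<open>T\<close>.\<close>

lemma det_characteristic_derivative:
  assumes a: "a \<in> A" and W:
    "\<And>w. W T w = w"
    "\<And>t w. t \<in> {0..T} \<Longrightarrow> ((\<lambda>t. W t w) has_vector_derivative
        jacobian (\<lambda>y. R y t a) (at (q t Q a)) *v W t w) (at t within {0..T})"
  shows "det (matrix (\<lambda>v. reindex (W 0 (unindex v)))) = exp (log_rho 0 Q a)"
proof -
  define M where "M t = matrix (\<lambda>v. reindex (W t (unindex v)))" for t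
  define J where "J t = jacobian (\<lambda>y. R y t a) (at (q t Q a))" for t
  define J' where "J' t = matrix (\<lambda>v. reindex (J t *v unindex v))" for t
  have J': "J' t *v v = reindex (J t *v unindex v)" for t v
  proof -
    have "linear (\<lambda>v. reindex (J t *v unindex v))"
      using linear_compose[OF linear_compose[OF linear_unindex matrix_vector_mul_linear] linear_reindex]
      by (simp add: o_def)
    then show ?thesis unfolding J'_def by (simp add: matrix_vector_mul(2))
  qed
  have M_nth: "M t $ i $ j = W t (unindex (axis j 1)) $ of_ordered i" for t i j
    by (simp add: M_def matrix_def reindex_def)
  have dM: "((\<lambda>t. M t $ i $ j) has_real_derivative (J' t ** M t) $ i $ j) (at t within {0..T})"
    if t: "t \<in> {0..T}" for t i j
  proof -
    have "((\<lambda>t. W t (unindex (axis j 1)) $ of_ordered i) has_vector_derivative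
        (J t *v W t (unindex (axis j 1))) $ of_ordered i) (at t within {0..T})"
      using bounded_linear.has_vector_derivative[OF bounded_linear_vec_nth W(2)[OF t]] by (simp add: J_def)
    moreover have "(J' t ** M t) $ i $ j = (J' t *v column j (M t)) $ i"
      by (simp add: matrix_matrix_mult_def matrix_vector_mult_def column_def)
    moreover have "unindex (column j (M t)) = W t (unindex (axis j 1))"
      by (simp add: vec_eq_iff unindex_def column_def M_nth to_ordered_inverse)
    ultimately show ?thesis
      unfolding has_real_derivative_iff_has_vector_derivative by (simp add: J' M_nth reindex_def)
  qed
  have trace: "trace (J' t) = div_field R a (q t Q a) t" for t
  proof -
    have "unindex (axis i 1) = axis (of_ordered i) 1" for i :: "'d ordered"
      by (auto simp: vec_eq_iff unindex_def axis_def to_ordered_inverse of_ordered_inverse)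
    then have "J' t $ i $ i = J t $ of_ordered i $ of_ordered i" for i
      by (simp add: J'_def matrix_def reindex_def matrix_vector_mult_basis column_def)
    then have "trace (J' t) = (\<Sum>i\<in>UNIV. J t $ of_ordered i $ of_ordered i)" by (simp add: trace_def)
    also have "\<dots> = trace (J t)"
      unfolding trace_def using sum.reindex_bij_betw[OF bij_of_ordered, of "\<lambda>i. J t $ i $ i"] by simp
    finally show ?thesis by (simp add: div_field_def divergence_def J_def)
  qed
  have "\<exists>c. \<forall>t\<in>{0..T}. det (M t) * exp (- log_rho t Q a) = c"
  proof (rule has_field_derivative_zero_constant)
    fix t assume t: "t \<in> {0..T}"
    have l: "((\<lambda>t. log_rho t Q a) has_real_derivative trace (J' t)) (at t within {0..T})"
      using log_density a t by (auto simp: solves_ode_on_def has_real_derivative_iff_has_vector_derivative trace)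
    show "((\<lambda>t. det (M t) * exp (- log_rho t Q a)) has_real_derivative 0) (at t within {0..T})"
      by (rule derivative_eq_intros liouville_det[OF dM[OF t]] l refl | simp)+
  qed simp
  then have "det (M 0) * exp (- log_rho 0 Q a) = det (M T) * exp (- log_rho T Q a)"
    using T_pos by force
  moreover have "M T = mat 1"
    by (auto simp: vec_eq_iff M_nth W(1) unindex_def to_ordered_inverse of_ordered_inverse mat_def axis_def of_ordered_inject)
  ultimately have "det (M 0) * exp (- log_rho 0 Q a) = 1"
    using log_density a by simp
  then show ?thesis by (simp add: M_def exp_minus field_simps)
qed

end

section \<open>The transported density\<close>

lemma AE_lborel_eq_on_open:
  fixes f g :: "'a::euclidean_space \<Rightarrow> real"
  assumes S: "open S" and f: "continuous_on S f" and g: "continuous_on S g"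
    and ae: "AE x in lborel. x \<in> S \<longrightarrow> f x = g x" and x: "x \<in> S"
  shows "f x = g x"
proof (rule ccontr)
  assume "f x \<noteq> g x"
  define N where "N = S \<inter> (\<lambda>x. f x - g x) -` (- {0})"
  have "open N" unfolding N_def using f g S
    by (intro continuous_open_preimage continuous_on_diff) auto
  moreover have "x \<in> N" using x \<open>f x \<noteq> g x\<close> by (simp add: N_def)
  ultimately have "\<not> negligible N" using open_not_negligible by blast
  moreover have "N \<in> null_sets lborel"
  proof -
    have "AE x in lborel. x \<notin> N" using ae by eventually_elim (auto simp: N_def)
    moreover have "N \<in> sets lborel" using \<open>open N\<close> by simp
    ultimately show ?thesis by (simp add: AE_iff_null_sets[symmetric])
  qed
  ultimately show False by (simp add: negligible_iff_null_sets null_sets_completionI)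
qed

context characteristic_flow
begin

text \<open>The time-\<open>T\<close> flow and the backward map invert each other, by uniqueness of solutions.\<close>

lemma flow_inverse:
  assumes a: "a \<in> A"
    and flow: "\<And>x. \<Phi> 0 x a = x" "\<And>x. solves_ode_on {0..T} (\<lambda>t y. R y t a) (\<lambda>t. \<Phi> t x a)"
  shows "q 0 (\<Phi> T x a) a = x" and "\<Phi> T (q 0 Q a) a = Q" and "inv (\<lambda>x. \<Phi> T x a) Q = q 0 Q a"
proof -
  obtain L where L: "\<And>x y t a. t \<in> {0..T} \<Longrightarrow> a \<in> A \<Longrightarrow> norm (R x t a - R y t a) \<le> L * norm (x - y)"
    using R_norm_diff_le by blast
  have 0: "0 \<in> {0..T}" "T \<in> {0..T}" using T_pos by auto
  have sol: "solves_ode_on {0..T} (\<lambda>t y. R y t a) (\<lambda>t. q t Q a)" "q T Q a = Q" for Q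
    using characteristic a by auto
  have 1: "q 0 (\<Phi> T x a) a = x" for x
    using ode_solution_unique[OF sol(1)[of "\<Phi> T x a"] flow(2)[of x] L[OF _ a] 0(2) 0(1)] sol(2) flow(1) by simp
  have 2: "\<Phi> T (q 0 Q a) a = Q" for Q
    using ode_solution_unique[OF flow(2)[of "q 0 Q a"] sol(1)[of Q] L[OF _ a] 0] sol(2) flow(1) by simp
  show "q 0 (\<Phi> T x a) a = x" "\<Phi> T (q 0 Q a) a = Q" by (rule 1, rule 2)
  have "inj (\<lambda>x. \<Phi> T x a)" using 1 by (metis injI)
  then show "inv (\<lambda>x. \<Phi> T x a) Q = q 0 Q a" by (rule inv_f_eq) (rule 2)
qed

lemma backward_map_derivative:
  assumes a: "a \<in> A"
  shows "\<exists>g'. ((\<lambda>Q. q 0 Q a) has_derivative g') (at Q) \<and>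
      \<bar>det (matrix (\<lambda>v. reindex (g' (unindex v))))\<bar> = exp (log_rho 0 Q a)"
proof -
  obtain W :: "real \<Rightarrow> ((real^'d) \<times> (real^'p)) \<Rightarrow>\<^sub>L (real^'d)" and K where W:
    "\<And>w u. W T (w, u) = w"
    "\<And>t. t \<in> {0..T} \<Longrightarrow> ((\<lambda>(Q, a). q t Q a) has_derivative blinfun_apply (W t)) (at (Q, a))"
    "\<And>t w u. t \<in> {0..T} \<Longrightarrow> ((\<lambda>t. W t (w, u)) has_vector_derivative
        jacobian (\<lambda>y. R y t a) (at (q t Q a)) *v W t (w, u)
        + jacobian (\<lambda>b. R (q t Q a) t b) (at a) *v u) (at t within {0..T})"
    "\<forall>\<^sub>F z in nhds (Q, a). snd z \<in> A \<and>
        (\<forall>t\<in>{0..T}. norm (q t (fst z) (snd z) - q t Q a) \<le> K * norm (z - (Q, a)))"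
    by (rule characteristic_differentiable[OF a, of Q], rule that)
  have "((\<lambda>Q. (Q, a)) has_derivative (\<lambda>v. (v, 0))) (at Q)" by (auto intro!: derivative_eq_intros)
  from has_derivative_compose[OF this W(2)] T_pos
  have "((\<lambda>Q. q 0 Q a) has_derivative (\<lambda>v. W 0 (v, 0))) (at Q)" by simp
  moreover have "det (matrix (\<lambda>v. reindex (W 0 (unindex v, 0)))) = exp (log_rho 0 Q a)"
    by (rule det_characteristic_derivative[OF a, of "\<lambda>t v. W t (v, 0)"])
       (use W(1) W(3)[of _ _ 0] in auto)
  ultimately show ?thesis by (intro exI[of _ "\<lambda>v. W 0 (v, 0)"]) simp
qed

lemma log_rho_differentiable:
  assumes a: "a \<in> A"
  shows "(\<lambda>(Q, a). log_rho 0 Q a) differentiable at (Q, a)"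
proof (rule characteristic_differentiable[OF a, of Q])
  fix W :: "real \<Rightarrow> ((real^'d) \<times> (real^'p)) \<Rightarrow>\<^sub>L (real^'d)" and K :: real
  assume W: "\<And>t. t \<in> {0..T} \<Longrightarrow> ((\<lambda>(Q, a). q t Q a) has_derivative blinfun_apply (W t)) (at (Q, a))"
    "\<forall>\<^sub>F z in nhds (Q, a). snd z \<in> A \<and>
        (\<forall>t\<in>{0..T}. norm (q t (fst z) (snd z) - q t Q a) \<le> K * norm (z - (Q, a)))"
  show ?thesis
    using log_rho_has_derivative(2)[OF a W] unfolding differentiable_def by blast
qed

lemma backward_map_continuous: "continuous_on UNIV (\<lambda>Q. q 0 Q a)" if "a \<in> A"
  unfolding continuous_on_eq_continuous_at[OF open_UNIV]
  using backward_map_derivative[OF that] has_derivative_continuous by blast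

lemma log_rho_continuous: "continuous_on UNIV (\<lambda>Q. log_rho 0 Q a)" if "a \<in> A"
proof -
  have "isCont (\<lambda>Q. log_rho 0 Q a) Q" for Q
  proof -
    have "isCont (\<lambda>Q. (Q, a)) Q" by (intro continuous_intros)
    from isCont_o2[OF this differentiable_imp_continuous_within[OF log_rho_differentiable[OF that]]]
    show ?thesis by simp
  qed
  then show ?thesis by (simp add: continuous_on_eq_continuous_at)
qed

text \<open>The density of the push-forward of \<open>f0\<close> by the flow, written with the backward map.\<close>

lemma transported_density_AE:
  assumes a: "a \<in> A"
    and flow: "\<And>x. \<Phi> 0 x a = x" "\<And>x. solves_ode_on {0..T} (\<lambda>t y. R y t a) (\<lambda>t. \<Phi> t x a)"
    and f0: "f0 \<in> borel_measurable borel" "\<And>x. 0 \<le> f0 x" and fT: "\<And>Q. 0 \<le> fT Q"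
    and push: "distributed (density_measure f0) lborel (\<lambda>x. \<Phi> T x a) (\<lambda>Q. ennreal (fT Q))"
  shows "AE Q in lborel. fT Q = exp (log_rho 0 Q a) * f0 (q 0 Q a)"
proof -
  obtain g' where g': "\<And>Q. ((\<lambda>Q. q 0 Q a) has_derivative g' Q) (at Q)"
      "\<And>Q. \<bar>det (matrix (\<lambda>v. reindex (g' Q (unindex v))))\<bar> = exp (log_rho 0 Q a)"
    using backward_map_derivative[OF a] by metis
  have J [measurable]: "(\<lambda>Q. exp (log_rho 0 Q a)) \<in> borel_measurable borel"
    by (intro borel_measurable_continuous_onI continuous_intros log_rho_continuous a)
  have [measurable]: "(\<lambda>Q. q 0 Q a) \<in> borel_measurable borel" "f0 \<in> borel_measurable borel"
    using backward_map_continuous[OF a] f0 by (auto intro: borel_measurable_continuous_onI)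
  have "(\<lambda>x. \<Phi> T x a) \<in> measurable (density_measure f0) lborel"
    using push by (simp add: distributed_def)
  then have \<Phi>: "(\<lambda>x. \<Phi> T x a) \<in> borel_measurable borel"
    by (simp add: density_measure_def measurable_def)
  have "density lborel (\<lambda>Q. ennreal (fT Q)) = distr (density_measure f0) lborel (\<lambda>x. \<Phi> T x a)"
    using push by (simp add: distributed_def)
  also have "\<dots> = density lborel (\<lambda>Q. ennreal (exp (log_rho 0 Q a)) * ennreal (f0 (q 0 Q a)))"
    unfolding density_measure_def
    by (rule distr_density_inverse_diffeo[OF _ _ g'(1) J g'(2) \<Phi>]) (use flow_inverse[where \<Phi> = \<Phi>, OF a flow] f0 in auto)
  finally have "AE Q in lborel. ennreal (fT Q) = ennreal (exp (log_rho 0 Q a)) * ennreal (f0 (q 0 Q a))"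
    using push by (intro sigma_finite_measure.density_unique[OF sigma_finite_lborel]) (auto simp: distributed_def)
  then show ?thesis
    by eventually_elim (use fT f0(2) in \<open>auto simp: ennreal_mult[symmetric]\<close>)
qed

text \<open>Where both sides are continuous, the almost everywhere identity holds at every point.\<close>

lemma transported_density_eq:
  assumes a: "a \<in> A"
    and flow: "\<And>x. \<Phi> 0 x a = x" "\<And>x. solves_ode_on {0..T} (\<lambda>t y. R y t a) (\<lambda>t. \<Phi> t x a)"
    and f0: "f0 \<in> borel_measurable borel" "\<And>x. 0 \<le> f0 x" and fT: "\<And>Q. 0 \<le> fT Q"
    and push: "distributed (density_measure f0) lborel (\<lambda>x. \<Phi> T x a) (\<lambda>Q. ennreal (fT Q))"
    and U: "open U" "continuous_on U f0" "continuous_on ((\<lambda>x. \<Phi> T x a) ` U) fT"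
    and Q: "q 0 Q a \<in> U"
  shows "fT Q = exp (log_rho 0 Q a) * f0 (q 0 Q a)"
proof (rule AE_lborel_eq_on_open[where S = "(\<lambda>Q. q 0 Q a) -` U" and f = fT and x = Q
      and g = "\<lambda>Q. exp (log_rho 0 Q a) * f0 (q 0 Q a)"])
  show "open ((\<lambda>Q. q 0 Q a) -` U)"
    using continuous_open_preimage[OF backward_map_continuous[OF a] open_UNIV U(1)] by simp
  show "continuous_on ((\<lambda>Q. q 0 Q a) -` U) fT"
  proof (rule continuous_on_subset[OF U(3)])
    show "(\<lambda>Q. q 0 Q a) -` U \<subseteq> (\<lambda>x. \<Phi> T x a) ` U"
    proof
      fix Q assume "Q \<in> (\<lambda>Q. q 0 Q a) -` U"
      then show "Q \<in> (\<lambda>x. \<Phi> T x a) ` U"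
        using flow_inverse(2)[where \<Phi> = \<Phi>, OF a flow, of Q] by (intro image_eqI[of _ _ "q 0 Q a"]) auto
    qed
  qed
  show "continuous_on ((\<lambda>Q. q 0 Q a) -` U) (\<lambda>Q. exp (log_rho 0 Q a) * f0 (q 0 Q a))"
    by (intro continuous_intros continuous_on_subset[OF log_rho_continuous[OF a]]
        continuous_on_compose2[OF U(2)] continuous_on_subset[OF backward_map_continuous[OF a]]) auto
  show "AE Q in lborel. Q \<in> (\<lambda>Q. q 0 Q a) -` U \<longrightarrow> fT Q = exp (log_rho 0 Q a) * f0 (q 0 Q a)"
    using transported_density_AE[where \<Phi> = \<Phi>, OF a flow f0 fT push] by eventually_elim simp
qed (use Q in simp)

text \<open>Uniqueness for the matrix equation, argued for the images \<open>X t *v u\<close> of each vector \<open>u\<close>.\<close>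

lemma sensitivity_equation_unique:
  fixes X Y :: "real \<Rightarrow> real^'m^'d"
  assumes a: "a \<in> A" and T: "X T = Y T"
    and sol: "solves_ode_on {0..T} (\<lambda>t M. jacobian (\<lambda>y. R y t a) (at (q t Q a)) ** M + B t) X"
      "solves_ode_on {0..T} (\<lambda>t M. jacobian (\<lambda>y. R y t a) (at (q t Q a)) ** M + B t) Y"
    and t: "t \<in> {0..T}"
  shows "X t = Y t"
proof -
  define J where "J t = jacobian (\<lambda>y. R y t a) (at (q t Q a))" for t
  have cq: "continuous_on {0..T} (\<lambda>t. q t Q a)" using characteristic a continuous_on_solution by blast
  have "continuous_on {0..T} (\<lambda>t. DR (q t Q a, t, a))"
    by (rule continuous_on_compose2[OF DR(2)])
       (use a in \<open>auto intro!: continuous_intros cq\<close>)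
  then have "bounded ((\<lambda>t. DR (q t Q a, t, a)) ` {0..T})"
    by (intro compact_imp_bounded compact_continuous_image compact_Icc)
  then obtain L where L: "\<forall>t\<in>{0..T}. norm (DR (q t Q a, t, a)) \<le> L" unfolding bounded_iff by blast
  have lin: "bounded_linear (\<lambda>M :: real^'m^'d. M *v u)" for u
    unfolding linear_conv_bounded_linear[symmetric]
    by (rule linearI) (simp_all add: matrix_vector_mult_add_rdistrib scaleR_matrix_vector_assoc)
  have sol_col: "solves_ode_on {0..T} (\<lambda>t v. J t *v v + B t *v u) (\<lambda>t. Z t *v u)"
    if "solves_ode_on {0..T} (\<lambda>t M. J t ** M + B t) Z" for Z u
    unfolding solves_ode_on_def
  proof
    fix t assume "t \<in> {0..T}"
    with that have "(Z has_vector_derivative J t ** Z t + B t) (at t within {0..T})" by (simp add: solves_ode_on_def)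
    from bounded_linear.has_vector_derivative[OF lin this, of u]
    show "((\<lambda>t. Z t *v u) has_vector_derivative J t *v (Z t *v u) + B t *v u) (at t within {0..T})"
      by (simp add: matrix_vector_mult_add_rdistrib matrix_vector_mul_assoc)
  qed
  have "X t *v u = Y t *v u" for u
  proof (rule ode_solution_unique[OF sol_col sol_col _ _ t, of _ _ _ L T])
    show "T \<in> {0..T}" using T_pos by simp
    fix s v w assume s: "s \<in> {0..T}"
    have "norm ((J s *v v + B s *v u) - (J s *v w + B s *v u)) = norm (DR (q s Q a, s, a) (v - w, 0, 0))"
      unfolding R_derivative_state[OF s a, symmetric] J_def matrix_vector_mult_diff_distrib by simp
    also have "\<dots> \<le> norm (DR (q s Q a, s, a)) * norm (v - w)"
      using norm_blinfun[of "DR (q s Q a, s, a)" "(v - w, 0, 0)"] by (simp add: norm_Pair)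
    also have "\<dots> \<le> L * norm (v - w)" using L s by (intro mult_right_mono) auto
    finally show "norm ((J s *v v + B s *v u) - (J s *v w + B s *v u)) \<le> L * norm (v - w)" .
  qed (use sol T in \<open>auto simp: J_def\<close>)
  then show ?thesis by (simp add: matrix_eq)
qed

end

section \<open>The Eulerian sensitivity\<close>

lemma has_vector_derivative_matrix:
  fixes M :: "real \<Rightarrow> real^'n^'m"
  assumes "\<And>i j. ((\<lambda>t. M t $ i $ j) has_vector_derivative M' $ i $ j) (at t within S)"
  shows "(M has_vector_derivative M') (at t within S)"
  unfolding has_vector_derivative_def has_derivative_componentwise_within[of M]
proof
  fix b :: "real^'n^'m" assume "b \<in> Basis"
  then obtain i j where b: "b = axis i (axis j 1)" by (auto simp: Basis_vec_def)
  show "((\<lambda>x. M x \<bullet> b) has_derivative (\<lambda>x. x *\<^sub>R M' \<bullet> b)) (at t within S)"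
    using assms[of i j] by (simp add: b inner_axis has_vector_derivative_def)
qed

theorem theorem3p4:
  fixes T :: real
    and A :: "(real ^ 'p) set"
    and R :: "real ^ 'd \<Rightarrow> real \<Rightarrow> real ^ 'p \<Rightarrow> real ^ 'd"
    and f0 :: "real ^ 'd \<Rightarrow> real"
    and \<Omega> :: "(real ^ 'd) set"
    and \<Phi> :: "real \<Rightarrow> real ^ 'd \<Rightarrow> real ^ 'p \<Rightarrow> real ^ 'd"
    and f :: "real ^ 'd \<Rightarrow> real \<Rightarrow> real ^ 'p \<Rightarrow> real"
    and q :: "real \<Rightarrow> real ^ 'd \<Rightarrow> real ^ 'p \<Rightarrow> real ^ 'd"
    and log_rho :: "real \<Rightarrow> real ^ 'd \<Rightarrow> real ^ 'p \<Rightarrow> real"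
    and \<alpha> :: "real ^ 'p"
    and Q\<^sub>T :: "real ^ 'd"
  assumes T_pos: "0 < T"
    and A_open: "open A"
    and R_C1: "C1_on (UNIV \<times> {0..T} \<times> A) (\<lambda>(x, t, a). R x t a)"
    and R_lipschitz: "\<exists>L. \<forall>t\<in>{0..T}. \<forall>a\<in>A. L-lipschitz_on UNIV (\<lambda>x. R x t a)"
    and L\<^sub>R_finite: "bdd_above ((\<lambda>(x, t, a). onorm (frechet_derivative (\<lambda>y. R y t a) (at x)))
                        ` (UNIV \<times> {0..T} \<times> A))"
    and h_C1: "\<forall>t\<in>{0..T}. C1_on (UNIV \<times> A) (\<lambda>(x, a). div_field R a x t)"
    and h_deriv_bounded:
      "\<forall>B. bounded B \<longrightarrow> (\<exists>C. \<forall>x\<in>B. \<forall>t\<in>{0..T}. \<forall>a\<in>A.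
          norm (grad (\<lambda>b. div_field R b x t) a) \<le> C \<and>
          norm (grad (\<lambda>y. div_field R a y t) x) \<le> C)"
    and f0_density: "prob_density f0"
    and f0_support: "is_support f0 \<Omega>"
    and f0_C1: "C1_on (interior \<Omega>) f0"
    and f0_pos: "\<forall>x\<in>interior \<Omega>. 0 < f0 x"
    and f0_full: "AE x in density_measure f0. x \<in> interior \<Omega>"
    and f0_score: "set_integrable (density_measure f0) (interior \<Omega>)
                     (\<lambda>x. (norm (grad (\<lambda>y. ln (f0 y)) x))\<^sup>2)"
    and flow: "\<forall>a\<in>A. \<forall>x. \<Phi> 0 x a = x \<and> solves_ode_on {0..T} (\<lambda>t y. R y t a) (\<lambda>t. \<Phi> t x a)"
    and f_nonneg: "\<forall>a\<in>A. \<forall>t\<in>{0..T}. \<forall>x. 0 \<le> f x t a"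
    and f_pushforward: "\<forall>a\<in>A. \<forall>t\<in>{0..T}.
          distributed (density_measure f0) lborel (\<lambda>x. \<Phi> t x a) (\<lambda>x. ennreal (f x t a))"
    and f_C1: "\<forall>a\<in>A. C1_on {(\<Phi> t x a, t) | x t. x \<in> interior \<Omega> \<and> t \<in> {0..T}} (\<lambda>(x, t). f x t a)"
    and characteristic: "\<forall>a\<in>A. \<forall>Q. q T Q a = Q \<and>
          solves_ode_on {0..T} (\<lambda>t y. R y t a) (\<lambda>t. q t Q a)"
    and log_density: "\<forall>a\<in>A. \<forall>Q. log_rho T Q a = 0 \<and>
          solves_ode_on {0..T} (\<lambda>t _. div_field R a (q t Q a) t) (\<lambda>t. log_rho t Q a)"
    and \<alpha>_in: "\<alpha> \<in> A"
    and Q\<^sub>T_in: "inv (\<lambda>x. \<Phi> T x \<alpha>) Q\<^sub>T \<in> interior \<Omega>"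
  shows
    "let S = char_sens q Q\<^sub>T \<alpha>;
         r = grad (\<lambda>a. log_rho 0 Q\<^sub>T a) \<alpha>;
         S_rhs = (\<lambda>t M. jacobian (\<lambda>y. R y t \<alpha>) (at (q t Q\<^sub>T \<alpha>)) ** M
                        + jacobian (\<lambda>a. R (q t Q\<^sub>T \<alpha>) t a) (at \<alpha>));
         integrand = (\<lambda>t. grad (\<lambda>a. div_field R a (q t Q\<^sub>T \<alpha>) t) \<alpha>
                          + grad (\<lambda>y. div_field R \<alpha> y t) (q t Q\<^sub>T \<alpha>) v* S t)
     in (\<lambda>a. ln (f Q\<^sub>T T a)) differentiable at \<alpha> \<and>
        eulerian_sens f Q\<^sub>T T \<alpha>
          = transpose (S 0) *v grad (\<lambda>y. ln (f0 y)) (q 0 Q\<^sub>T \<alpha>) + r \<and>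
        (\<lambda>a. log_rho 0 Q\<^sub>T a) differentiable at \<alpha> \<and>
        integrand absolutely_integrable_on {0..T} \<and>
        r = - integral {0..T} integrand \<and>
        (\<forall>t\<in>{0..T}. (\<lambda>a. q t Q\<^sub>T a) differentiable at \<alpha>) \<and>
        S T = 0 \<and> solves_ode_on {0..T} S_rhs S \<and>
        (\<forall>Y. Y T = 0 \<and> solves_ode_on {0..T} S_rhs Y \<longrightarrow> (\<forall>t\<in>{0..T}. Y t = S t))"
proof -
  interpret characteristic_flow T A R q log_rho
    by (unfold_locales) (fact T_pos A_open R_C1 R_lipschitz h_C1 h_deriv_bounded characteristic log_density)+
  have flow': "\<And>x. \<Phi> 0 x a = x" "\<And>x. solves_ode_on {0..T} (\<lambda>t y. R y t a) (\<lambda>t. \<Phi> t x a)" if "a \<in> A" for a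
    using flow that by auto
  have 0: "0 \<in> {0..T}" "T \<in> {0..T}" using T_pos by auto
  define J where "J t = jacobian (\<lambda>y. R y t \<alpha>) (at (q t Q\<^sub>T \<alpha>))" for t
  define B where "B t = jacobian (\<lambda>a. R (q t Q\<^sub>T \<alpha>) t a) (at \<alpha>)" for t
  define S where "S = char_sens q Q\<^sub>T \<alpha>"
  define gq where "gq t = grad (\<lambda>y. div_field R \<alpha> y t) (q t Q\<^sub>T \<alpha>)" for t
  define ga where "ga t = grad (\<lambda>a. div_field R a (q t Q\<^sub>T \<alpha>) t) \<alpha>" for t
  define integrand where "integrand t = ga t + gq t v* S t" for t
  define r where "r = grad (\<lambda>a. log_rho 0 Q\<^sub>T a) \<alpha>"
  obtain W :: "real \<Rightarrow> ((real^'d) \<times> (real^'p)) \<Rightarrow>\<^sub>L (real^'d)" and K where W: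
    "\<And>w u. W T (w, u) = w"
    "\<And>t. t \<in> {0..T} \<Longrightarrow> ((\<lambda>(Q, a). q t Q a) has_derivative blinfun_apply (W t)) (at (Q\<^sub>T, \<alpha>))"
    "\<And>t w u. t \<in> {0..T} \<Longrightarrow> ((\<lambda>t. W t (w, u)) has_vector_derivative
        jacobian (\<lambda>y. R y t \<alpha>) (at (q t Q\<^sub>T \<alpha>)) *v W t (w, u)
        + jacobian (\<lambda>b. R (q t Q\<^sub>T \<alpha>) t b) (at \<alpha>) *v u) (at t within {0..T})"
    "\<forall>\<^sub>F z in nhds (Q\<^sub>T, \<alpha>). snd z \<in> A \<and>
        (\<forall>t\<in>{0..T}. norm (q t (fst z) (snd z) - q t Q\<^sub>T \<alpha>) \<le> K * norm (z - (Q\<^sub>T, \<alpha>)))"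
    by (rule characteristic_differentiable[OF \<alpha>_in, of Q\<^sub>T], rule that)
  have emb: "((\<lambda>a. (Q\<^sub>T, a)) has_derivative (\<lambda>u. (0, u))) (at \<alpha>)" by (auto intro!: derivative_eq_intros)
  have dq: "((\<lambda>a. q t Q\<^sub>T a) has_derivative (\<lambda>u. W t (0, u))) (at \<alpha>)" if "t \<in> {0..T}" for t
    using has_derivative_compose[OF emb W(2)[OF that]] by simp
  have S: "S t *v u = W t (0, u)" if "t \<in> {0..T}" for t u
    unfolding S_def char_sens_def by (rule jacobian_eq[OF dq[OF that]])
  have S_nth: "S t $ i $ j = W t (0, axis j 1) $ i" if "t \<in> {0..T}" for t i j
    using S[OF that, of "axis j 1"] by (simp add: matrix_vector_mult_basis column_def vec_eq_iff)
  have ST: "S T = 0" using S_nth[OF 0(2)] W(1) by (simp add: vec_eq_iff)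
  have ode: "solves_ode_on {0..T} (\<lambda>t M. J t ** M + B t) S"
    unfolding solves_ode_on_def
  proof
    fix t assume t: "t \<in> {0..T}"
    show "(S has_vector_derivative J t ** S t + B t) (at t within {0..T})"
    proof (rule has_vector_derivative_matrix)
      fix i j
      have "((\<lambda>t. W t (0, axis j 1) $ i) has_vector_derivative
          (J t *v W t (0, axis j 1) + B t *v axis j 1) $ i) (at t within {0..T})"
        using bounded_linear.has_vector_derivative[OF bounded_linear_vec_nth W(3)[OF t]] by (simp add: J_def B_def)
      moreover have "(J t *v W t (0, axis j 1) + B t *v axis j 1) $ i = (J t ** S t + B t) $ i $ j"
      proof -
        have "J t *v column j (S t) = column j (J t ** S t)"
          by (simp add: vec_eq_iff column_def matrix_vector_mult_def matrix_matrix_mult_def)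
        then show ?thesis
          unfolding S[OF t, symmetric] matrix_vector_mult_basis by (simp add: column_def)
      qed
      ultimately show "((\<lambda>t. S t $ i $ j) has_vector_derivative (J t ** S t + B t) $ i $ j) (at t within {0..T})"
        using S_nth t by (auto intro: has_vector_derivative_transform)
    qed
  qed
  have unique: "Y t = S t" if "Y T = 0" "solves_ode_on {0..T} (\<lambda>t M. J t ** M + B t) Y" "t \<in> {0..T}" for Y t
    using sensitivity_equation_unique[OF \<alpha>_in, of Y S Q\<^sub>T B t] that ST ode by (simp add: J_def)
  have ig: "gq t \<bullet> W t (0, u) + ga t \<bullet> u = integrand t \<bullet> u" if "t \<in> {0..T}" for t u
    by (simp add: integrand_def S[OF that, symmetric] dot_lmul_matrix inner_add_left)
  \<comment> \<open>in direction \<open>(0, u)\<close> the derivative of \<open>log_rho 0\<close> is minus the integral of \<open>integrand t \<bullet> u\<close>\<close>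
  note lr = log_rho_has_derivative[OF \<alpha>_in W(2) W(4), folded gq_def ga_def]
  have int_u: "(\<lambda>t. integrand t \<bullet> u) absolutely_integrable_on {0..T}" for u
  proof -
    have "(\<lambda>t. gq t \<bullet> W t (0, u) + ga t \<bullet> u) absolutely_integrable_on {0..T}
        \<longleftrightarrow> (\<lambda>t. integrand t \<bullet> u) absolutely_integrable_on {0..T}"
      by (rule set_integrable_cong[OF refl refl]) (rule ig)
    then show ?thesis using lr(1)[of "(0, u)"] by simp
  qed
  have int: "integrand absolutely_integrable_on {0..T}"
    by (rule absolutely_integrable_componentwise) (rule int_u)
  have intg: "integral {0..T} (\<lambda>t. integrand t \<bullet> u) = integral {0..T} integrand \<bullet> u" for u
    using integral_linear[OF set_lebesgue_integral_eq_integral(1)[OF int] bounded_linear_inner_left[of u]]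
    by (simp add: o_def)
  have dl: "((\<lambda>a. log_rho 0 Q\<^sub>T a) has_derivative (\<lambda>u. - (integral {0..T} integrand \<bullet> u))) (at \<alpha>)"
  proof -
    have "integral {0..T} (\<lambda>t. gq t \<bullet> W t (0, u) + ga t \<bullet> u) = integral {0..T} integrand \<bullet> u" for u
      unfolding intg[symmetric] by (rule integral_cong) (rule ig)
    then show ?thesis using has_derivative_compose[OF emb lr(2)] by simp
  qed
  have r: "r = - integral {0..T} integrand"
    by (rule vector_eq_rdot[THEN iffD1, rule_format]) (simp add: r_def grad_eq[OF dl])
  \<comment> \<open>the formula for the transported density holds at all parameters near \<open>\<alpha>\<close>, as there the backward
    characteristic from \<open>Q\<^sub>T\<close> still starts in the open set \<open>interior \<Omega>\<close>\<close>
  have q0: "q 0 Q\<^sub>T \<alpha> \<in> interior \<Omega>"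
    using Q\<^sub>T_in flow_inverse(3)[where \<Phi> = \<Phi>, OF \<alpha>_in flow'[OF \<alpha>_in]] by simp
  have f_eq: "f Q\<^sub>T T a = exp (log_rho 0 Q\<^sub>T a) * f0 (q 0 Q\<^sub>T a)" if a: "a \<in> A" "q 0 Q\<^sub>T a \<in> interior \<Omega>" for a
  proof (rule transported_density_eq[where \<Phi> = \<Phi>, OF a(1) flow'[OF a(1)]])
    show "f0 \<in> borel_measurable borel" "0 \<le> f0 x" for x using f0_density by (auto simp: prob_density_def)
    show "0 \<le> f Q T a" for Q using f_nonneg a 0 by auto
    show "distributed (density_measure f0) lborel (\<lambda>x. \<Phi> T x a) (\<lambda>x. ennreal (f x T a))"
      using f_pushforward a 0 by auto
    show "continuous_on (interior \<Omega>) f0"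
      using f0_C1 unfolding C1_on_def continuous_on_eq_continuous_within by (blast intro: has_derivative_continuous)
    have "continuous_on {(\<Phi> t x a, t) | x t. x \<in> interior \<Omega> \<and> t \<in> {0..T}} (\<lambda>(x, t). f x t a)"
      using f_C1 a unfolding C1_on_def continuous_on_eq_continuous_within by (blast intro: has_derivative_continuous)
    from continuous_on_compose2[OF this, of "(\<lambda>x. \<Phi> T x a) ` interior \<Omega>" "\<lambda>Q. (Q, T)"]
    show "continuous_on ((\<lambda>x. \<Phi> T x a) ` interior \<Omega>) (\<lambda>Q. f Q T a)"
      using 0 by (force intro!: continuous_intros)
  qed (use a in auto)
  have "\<forall>\<^sub>F a in nhds \<alpha>. a \<in> A" using A_open \<alpha>_in by (rule eventually_nhds_in_open)
  moreover have "\<forall>\<^sub>F a in nhds \<alpha>. q 0 Q\<^sub>T a \<in> interior \<Omega>"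
    using has_derivative_continuous[OF dq[OF 0(1)]] q0
    by (intro topological_tendstoD[where S = "interior \<Omega>"]) (auto simp: continuous_at tendsto_nhds_iff isCont_def)
  ultimately have near: "\<forall>\<^sub>F a in nhds \<alpha>. ln (f Q\<^sub>T T a) = log_rho 0 Q\<^sub>T a + ln (f0 (q 0 Q\<^sub>T a))"
    by eventually_elim (use f0_pos f_eq in \<open>auto simp: ln_mult\<close>)
  define g where "g = grad (\<lambda>y. ln (f0 y)) (q 0 Q\<^sub>T \<alpha>)"
  have df0: "((\<lambda>y. ln (f0 y)) has_derivative (\<lambda>v. g \<bullet> v)) (at (q 0 Q\<^sub>T \<alpha>))"
  proof -
    obtain D where "(f0 has_derivative D) (at (q 0 Q\<^sub>T \<alpha>) within interior \<Omega>)"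
      using f0_C1 q0 unfolding C1_on_def by blast
    then have "(f0 has_derivative D) (at (q 0 Q\<^sub>T \<alpha>))" using q0 by (simp add: at_within_open[OF _ open_interior])
    then have d: "((\<lambda>y. ln (f0 y)) has_derivative (\<lambda>v. D v / f0 (q 0 Q\<^sub>T \<alpha>))) (at (q 0 Q\<^sub>T \<alpha>))"
      using f0_pos q0 by (auto intro!: derivative_eq_intros simp: field_simps)
    then show ?thesis unfolding g_def grad_eq[OF d] .
  qed
  obtain V where V: "open V" "\<alpha> \<in> V"
    "\<forall>a\<in>V. ln (f Q\<^sub>T T a) = log_rho 0 Q\<^sub>T a + ln (f0 (q 0 Q\<^sub>T a))"
    using near unfolding eventually_nhds by blast
  have "((\<lambda>a. log_rho 0 Q\<^sub>T a + ln (f0 (q 0 Q\<^sub>T a))) has_derivative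
      (\<lambda>u. - (integral {0..T} integrand \<bullet> u) + g \<bullet> W 0 (0, u))) (at \<alpha>)"
    by (intro has_derivative_add dl has_derivative_compose[OF dq[OF 0(1)] df0])
  then have dL: "((\<lambda>a. ln (f Q\<^sub>T T a)) has_derivative
      (\<lambda>u. - (integral {0..T} integrand \<bullet> u) + g \<bullet> W 0 (0, u))) (at \<alpha>)"
    by (rule has_derivative_transform_within_open[OF _ V(1,2)]) (simp add: V(3))
  have G: "eulerian_sens f Q\<^sub>T T \<alpha> = transpose (S 0) *v g + r"
    by (rule vector_eq_rdot[THEN iffD1, rule_format])
      (simp add: eulerian_sens_def grad_eq[OF dL] r S[OF 0(1), symmetric] inner_diff_left dot_lmul_matrix)
  show ?thesis
    unfolding Let_def S_def[symmetric] r_def[symmetric] J_def[symmetric] B_def[symmetric]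
      gq_def[symmetric] ga_def[symmetric] g_def[symmetric] integrand_def[symmetric]
  proof (intro conjI)
    show "(\<lambda>a. ln (f Q\<^sub>T T a)) differentiable at \<alpha>" "(\<lambda>a. log_rho 0 Q\<^sub>T a) differentiable at \<alpha>"
      using dL dl unfolding differentiable_def by blast+
    show "\<forall>t\<in>{0..T}. (\<lambda>a. q t Q\<^sub>T a) differentiable at \<alpha>"
      using dq unfolding differentiable_def by blast
    show "\<forall>Y. Y T = 0 \<and> solves_ode_on {0..T} (\<lambda>t M. J t ** M + B t) Y \<longrightarrow> (\<forall>t\<in>{0..T}. Y t = S t)"
      using unique by blast
  qed (fact G int r ST ode)+
qed

end
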